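(* Let $(M,d)$ be a complete metric space with base point $0$. If $\phi\in\mathrm{Lip}_0(M)^*$ avoids infinity, then there is $\mu\in\mathcal{M}_{\mathrm{op}}(\beta\widetilde{M})$ such that $\Phi^*\mu=\phi$ and $\mathcal{S}(\phi)\subset\mathfrak{p}_s(\mathrm{supp}(\mu))\subset\mathcal{S}(\phi)\cup\{0\}$.
   Context: $(M,d)$ is a complete metric space with base point $0\in M$. $\mathrm{Lip}_0(M)$ is the Banach space of real-valued Lipschitz functions $f$ on $M$ with $f(0)=0$, normed by the optimal Lipschitz constant. $\widetilde{M}=\{(x,y)\in M\times M: x\neq y\}$ and $\beta\widetilde{M}$ is its Stone-Čech compactification. $\mathcal{M}(\beta\widetilde{M})$ is the Banach space (total variation norm) of signed (finite) Radon measures on $\beta\widetilde{M}$; $\mathrm{supp}(\mu)$ is the closed set of points all of whose open neighbourhoods have positive $|\mu|$-measure. $\Phi:\mathrm{Lip}_0(M)\to C(\beta\widetilde{M})$ is given by $(\Phi f)(x,y)=\frac{f(x)-f(y)}{d(x,y)}$ on $\widetilde{M}$, extended continuously to $\beta\widetilde{M}$; $\Phi^*:\mathcal{M}(\beta\widetilde{M})\to\mathrm{Lip}_0(M)^*$ is its adjoint. $\mathcal{M}_{\mathrm{op}}(\beta\widetilde{M})=\{\mu\in\mathcal{M}(\beta\widetilde{M}):\mu\geq 0,\ \|\mu\|=\|\Phi^*\mu\|\}$. $M^{\mathcal{U}}$ is the uniform (Samuel) compactification of $M$: the unique compactification to which every bounded uniformly continuous $f:M\to\mathbb{R}$ extends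 continuously and in which the closures of $A,B\subset M$ are disjoint iff $d(A,B)>0$. $\mathfrak{p}_i:\beta\widetilde{M}\to M^{\mathcal{U}}$ ($i=1,2$) is the continuous extension of the $i$-th coordinate projection on $\widetilde{M}$. For $E\subset\beta\widetilde{M}$, its shadow is $\mathfrak{p}_s(E)=\mathfrak{p}_1(E)\cup\mathfrak{p}_2(E)$. For $\phi\in\mathrm{Lip}_0(M)^*$, the extended support is $$\mathcal{S}(\phi)=\bigcap\left\{\overline{A}^{\mathcal{U}}: A\subset M\text{ and }\langle f,\phi\rangle=0\text{ whenever }f\in\mathrm{Lip}_0(M)\text{ and }f|_A=0\right\},$$ where $\overline{A}^{\mathcal{U}}$ is the closure of $A$ in $M^{\mathcal{U}}$. With $\rho(x)=d(x,0)$ and $n\in\mathbb{Z}$, let $h_n:M\to\mathbb{R}$ be $h_n(x)=1$ if $\rho(x)\leq 2^n$, $h_n(x)=2-2^{-n}\rho(x)$ if $2^n\leq\rho(x)\leq 2^{n+1}$, $h_n(x)=0$ if $\rho(x)\geq 2^{n+1}$; $W_{h_n}(f)=f\cdot h_n$ is a bounded operator on $\mathrm{Lip}_0(M)$. $\phi$ avoids infinity if $\lim_{n\to+\infty}W_{h_n}^*(\phi)=\phi$ in norm. *)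

theory Defs
  imports "HOL-Analysis.Analysis"
begin

section \<open>The space of Lipschitz functions vanishing at the base point\<close>

text \<open>
  A pointed metric space is a type of sort \<open>{metric_space, zero}\<close>: the class \<open>zero\<close> carries no
  axioms, so \<open>0\<close> is just an arbitrary distinguished point.
\<close>

typedef (overloaded) ('a::"{metric_space, zero}") lip0 =
  "{f :: 'a \<Rightarrow> real. f 0 = 0 \<and> (\<exists>C. C-lipschitz_on UNIV f)}"
  morphisms lip_fun Lip0
proof
  show "(\<lambda>_. 0) \<in> {f :: 'a \<Rightarrow> real. f 0 = 0 \<and> (\<exists>C. C-lipschitz_on UNIV f)}"
    by (auto intro!: exI[of _ 0] lipschitz_onI)
qed

setup_lifting type_definition_lip0

definition lip_const :: "('a::metric_space \<Rightarrow> real) \<Rightarrow> real" where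
  "lip_const f = Inf {C. C-lipschitz_on UNIV f}"

lemma lip_const_le: "C-lipschitz_on UNIV f \<Longrightarrow> lip_const f \<le> C"
  unfolding lip_const_def
  by (rule cInf_lower) (auto intro!: bdd_belowI[of _ 0] dest: lipschitz_on_nonneg)

lemma lip_const_lipschitz:
  assumes "C-lipschitz_on UNIV f"
  shows "(lip_const f)-lipschitz_on UNIV f"
proof (rule lipschitz_onI)
  have ne: "{C. C-lipschitz_on UNIV f} \<noteq> {}" using assms by auto
  show "0 \<le> lip_const f"
    unfolding lip_const_def by (rule cInf_greatest[OF ne]) (auto dest: lipschitz_on_nonneg)
  fix x y
  show "dist (f x) (f y) \<le> lip_const f * dist x y"
  proof (cases "x = y")
    case False
    then have d: "dist x y > 0" by simp
    have "dist (f x) (f y) / dist x y \<le> lip_const f"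
      unfolding lip_const_def
    proof (rule cInf_greatest[OF ne])
      fix C assume "C \<in> {C. C-lipschitz_on UNIV f}"
      then have "dist (f x) (f y) \<le> C * dist x y" by (auto dest: lipschitz_onD)
      then show "dist (f x) (f y) / dist x y \<le> C" using d by (simp add: field_simps)
    qed
    then show ?thesis using d by (simp add: field_simps)
  qed simp
qed

instantiation lip0 :: ("{metric_space, zero}") real_normed_vector
begin

lift_definition zero_lip0 :: "'a lip0" is "\<lambda>_. 0"
  by (auto intro!: exI[of _ 0] lipschitz_onI)

lift_definition plus_lip0 :: "'a lip0 \<Rightarrow> 'a lip0 \<Rightarrow> 'a lip0" is "\<lambda>f g x. f x + g x"
  by (auto intro: lipschitz_on_add)

lift_definition uminus_lip0 :: "'a lip0 \<Rightarrow> 'a lip0" is "\<lambda>f x. - f x"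
  by auto

lift_definition minus_lip0 :: "'a lip0 \<Rightarrow> 'a lip0 \<Rightarrow> 'a lip0" is "\<lambda>f g x. f x - g x"
  by (auto intro: lipschitz_on_diff)

lift_definition scaleR_lip0 :: "real \<Rightarrow> 'a lip0 \<Rightarrow> 'a lip0" is "\<lambda>c f x. c * f x"
  by (auto intro: lipschitz_on_cmult_real)

lift_definition norm_lip0 :: "'a lip0 \<Rightarrow> real" is lip_const .

definition dist_lip0 :: "'a lip0 \<Rightarrow> 'a lip0 \<Rightarrow> real" where
  "dist_lip0 f g = norm (f - g)"

definition sgn_lip0 :: "'a lip0 \<Rightarrow> 'a lip0" where
  "sgn_lip0 f = inverse (norm f) *\<^sub>R f"

definition uniformity_lip0 :: "('a lip0 \<times> 'a lip0) filter" where
  "uniformity_lip0 = (INF e\<in>{0 <..}. principal {(x, y). dist x y < e})"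

definition open_lip0 :: "'a lip0 set \<Rightarrow> bool" where
  "open_lip0 S = (\<forall>x\<in>S. \<forall>\<^sub>F (x', y) in uniformity. x' = x \<longrightarrow> y \<in> S)"

lemma norm_lip0_le: "C-lipschitz_on UNIV (lip_fun f) \<Longrightarrow> norm f \<le> C"
  by transfer (rule lip_const_le)

lemma norm_lip0_lipschitz: "(norm f)-lipschitz_on UNIV (lip_fun f)"
  by transfer (auto intro: lip_const_lipschitz)

lemma norm_lip0_scale_le: "norm (c *\<^sub>R f) \<le> \<bar>c\<bar> * norm f" for f :: "'a lip0"
proof (rule norm_lip0_le)
  show "(\<bar>c\<bar> * norm f)-lipschitz_on UNIV (lip_fun (c *\<^sub>R f))"
    unfolding scaleR_lip0.rep_eq by (rule lipschitz_on_cmult_real[OF norm_lip0_lipschitz])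
qed

instance
proof
  fix f g h :: "'a lip0" and a b :: real
  show "f + g + h = f + (g + h)" by transfer (auto simp: algebra_simps)
  show "f + g = g + f" by transfer (auto simp: algebra_simps)
  show "0 + f = f" by transfer auto
  show "- f + f = 0" by transfer auto
  show "f - g = f + - g" by transfer auto
  show "a *\<^sub>R (f + g) = a *\<^sub>R f + a *\<^sub>R g" by transfer (auto simp: algebra_simps)
  show "(a + b) *\<^sub>R f = a *\<^sub>R f + b *\<^sub>R f" by transfer (auto simp: algebra_simps)
  show "a *\<^sub>R b *\<^sub>R f = (a * b) *\<^sub>R f" by transfer (auto simp: algebra_simps)
  show "1 *\<^sub>R f = f" by transfer auto
  show "norm (f + g) \<le> norm f + norm g"
    by (rule norm_lip0_le)
      (auto simp: plus_lip0.rep_eq intro!: lipschitz_on_add norm_lip0_lipschitz)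
  have "0-lipschitz_on UNIV (lip_fun (0 :: 'a lip0))"
    by (rule lipschitz_onI) (simp_all add: zero_lip0.rep_eq)
  then have zero: "norm (0 :: 'a lip0) = 0"
    using norm_lip0_le lipschitz_on_nonneg[OF norm_lip0_lipschitz] by (metis order_antisym)
  show "norm f = 0 \<longleftrightarrow> f = 0"
  proof
    assume "norm f = 0"
    then have *: "dist (lip_fun f x) (lip_fun f 0) \<le> 0" for x
      using lipschitz_onD[OF norm_lip0_lipschitz[of f], of x 0] by simp
    have "lip_fun f 0 = 0" using lip_fun[of f] by simp
    with * have "lip_fun f x = lip_fun 0 x" for x by (simp add: zero_lip0.rep_eq)
    then show "f = 0" by (metis ext lip_fun_inject)
  qed (use zero in simp)
  show "norm (a *\<^sub>R f) = \<bar>a\<bar> * norm f"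
  proof (cases "a = 0")
    case True
    have "0 *\<^sub>R f = 0" by transfer auto
    then show ?thesis using True zero by simp
  next
    case False
    have "f = inverse a *\<^sub>R (a *\<^sub>R f)" using False by transfer auto
    then have "norm f \<le> \<bar>inverse a\<bar> * norm (a *\<^sub>R f)" by (metis norm_lip0_scale_le)
    then have "\<bar>a\<bar> * norm f \<le> norm (a *\<^sub>R f)" using False by (simp add: field_simps)
    then show ?thesis using norm_lip0_scale_le[of a f] by linarith
  qed
qed (rule dist_lip0_def sgn_lip0_def uniformity_lip0_def open_lip0_def)+

end

section \<open>Functionals avoiding infinity\<close>

definition h_cut :: "int \<Rightarrow> 'a::{metric_space, zero} \<Rightarrow> real" where
  "h_cut n x =
    (if dist x 0 \<le> 2 powi n then 1
     else if dist x 0 \<le> 2 powi (n + 1) then 2 - 2 powi (- n) * dist x 0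
     else 0)"

lemma h_cut_alt: "h_cut n x = max 0 (min 1 (2 - 2 powi (- n) * dist x 0))"
proof -
  define t :: real where "t = 2 powi n"
  define u where "u = dist x 0 / t"
  have t: "t > 0" by (simp add: t_def)
  have "(2::real) powi (n + 1) = 2 * t" by (simp add: t_def power_int_add)
  moreover have "2 powi (- n) * dist x 0 = u"
    by (simp add: u_def t_def power_int_minus field_simps)
  moreover have "dist x 0 \<le> t \<longleftrightarrow> u \<le> 1" "dist x 0 \<le> 2 * t \<longleftrightarrow> u \<le> 2"
    using t by (simp_all add: u_def divide_le_eq)
  ultimately show ?thesis
    unfolding h_cut_def t_def[symmetric] by auto
qed

lemma h_cut_mult_lipschitz:
  fixes f :: "'a::{metric_space, zero} \<Rightarrow> real"
  assumes f: "L-lipschitz_on UNIV f" and f0: "f 0 = 0"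
  shows "(3 * L)-lipschitz_on UNIV (\<lambda>x. f x * h_cut n x)"
proof (rule lipschitz_onI)
  have L: "0 \<le> L" by (rule lipschitz_on_nonneg[OF f])
  then show "0 \<le> 3 * L" by simp
  have p: "(2::real) powi n > 0" by simp
  have p1: "(2::real) powi (n + 1) = 2 * 2 powi n" by (simp add: power_int_add)
  have pm: "(2::real) powi (- n) = inverse (2 powi n)" by (simp add: power_int_minus)
  have hb: "0 \<le> h_cut n x" "h_cut n x \<le> 1" for x :: 'a
    by (auto simp: h_cut_alt)
  have h0: "h_cut n x = 0" if "dist x 0 > 2 powi (n + 1)" for x :: 'a
  proof -
    have "\<not> dist x 0 \<le> 2 powi n" using that p unfolding p1 by linarith
    then show ?thesis using that by (simp add: h_cut_def)
  qed
  have hl: "\<bar>h_cut n x - h_cut n y\<bar> \<le> 2 powi (- n) * dist x y" for x y :: 'a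
  proof -
    have "\<bar>h_cut n x - h_cut n y\<bar> \<le> \<bar>2 powi (- n) * dist x 0 - 2 powi (- n) * dist y 0\<bar>"
      unfolding h_cut_alt by linarith
    also have "\<dots> = 2 powi (- n) * \<bar>dist x 0 - dist y 0\<bar>"
      by (simp add: abs_mult flip: right_diff_distrib)
    also have "\<dots> \<le> 2 powi (- n) * dist x y"
      by (intro mult_left_mono) (use dist_triangle[of x 0 y] dist_triangle[of y 0 x] in
          \<open>auto simp: dist_commute\<close>)
    finally show ?thesis .
  qed
  have key: "\<bar>f x * h_cut n x - f y * h_cut n y\<bar> \<le> 3 * L * dist x y"
    if x: "dist x 0 \<le> 2 powi (n + 1)" for x y :: 'a
  proof -
    have "\<bar>f x\<bar> \<le> L * dist x 0" using lipschitz_onD[OF f, of x 0] f0 by (simp add: dist_real_def)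
    also have "\<dots> \<le> L * (2 * 2 powi n)" using x p1 L by (intro mult_left_mono) auto
    finally have fx: "\<bar>f x\<bar> \<le> L * (2 * 2 powi n)" .
    have "f x * h_cut n x - f y * h_cut n y
        = f x * (h_cut n x - h_cut n y) + h_cut n y * (f x - f y)"
      by (simp add: algebra_simps)
    then have "\<bar>f x * h_cut n x - f y * h_cut n y\<bar>
        \<le> \<bar>f x\<bar> * \<bar>h_cut n x - h_cut n y\<bar> + \<bar>h_cut n y\<bar> * \<bar>f x - f y\<bar>"
      by (metis abs_mult abs_triangle_ineq)
    also have "\<dots> \<le> L * (2 * 2 powi n) * (2 powi (- n) * dist x y) + 1 * (L * dist x y)"
      using lipschitz_onD[OF f, of x y] hb L fx hl[of x y] p
      by (intro add_mono mult_mono) (auto simp: dist_real_def)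
    also have "\<dots> = 3 * L * dist x y" using p pm by (simp add: field_simps)
    finally show ?thesis .
  qed
  fix x y :: 'a
  show "dist (f x * h_cut n x) (f y * h_cut n y) \<le> 3 * L * dist x y"
  proof (cases "dist x 0 \<le> 2 powi (n + 1)")
    case True
    then show ?thesis using key by (simp add: dist_real_def)
  next
    case False
    show ?thesis
    proof (cases "dist y 0 \<le> 2 powi (n + 1)")
      case True
      then show ?thesis using key[of y x] by (simp add: dist_real_def dist_commute abs_minus_commute)
    next
      case False
      then show ?thesis using \<open>\<not> dist x 0 \<le> 2 powi (n + 1)\<close> h0 L by simp
    qed
  qed
qed

lift_definition h_cut_mult :: "int \<Rightarrow> 'a::{metric_space, zero} lip0 \<Rightarrow> 'a lip0" is
  "\<lambda>n f x. f x * h_cut n x"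
  by (auto intro: h_cut_mult_lipschitz)

lift_definition W_cut :: "int \<Rightarrow> 'a::{metric_space, zero} lip0 \<Rightarrow>\<^sub>L 'a lip0" is h_cut_mult
proof (rule bounded_linear_intro)
  fix n :: int and f g :: "'a lip0" and r :: real
  show "h_cut_mult n (f + g) = h_cut_mult n f + h_cut_mult n g"
    by transfer (auto simp: algebra_simps)
  show "h_cut_mult n (r *\<^sub>R f) = r *\<^sub>R h_cut_mult n f"
    by transfer (auto simp: algebra_simps)
  have "lip_fun f 0 = 0" using lip_fun[of f] by simp
  then have "norm (h_cut_mult n f) \<le> 3 * norm f"
    by (intro norm_lip0_le)
      (simp add: h_cut_mult.rep_eq h_cut_mult_lipschitz norm_lip0_lipschitz)
  then show "norm (h_cut_mult n f) \<le> norm f * 3" by simp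
qed

definition avoids_infinity :: "('a::{metric_space, zero} lip0 \<Rightarrow>\<^sub>L real) \<Rightarrow> bool" where
  "avoids_infinity \<phi> \<longleftrightarrow> ((\<lambda>n. \<phi> o\<^sub>L W_cut n) \<longlongrightarrow> \<phi>) at_top"

section \<open>Compactifications\<close>

text \<open>
  Compactifications are unique only up to homeomorphism, so they are treated through their
  defining properties; lemmas \<open>stone_cech_exists\<close> and \<open>samuel_exists\<close> below provide models.
\<close>

definition compactification :: "'x topology \<Rightarrow> ('x \<Rightarrow> 'k) \<Rightarrow> 'k topology \<Rightarrow> bool" where
  "compactification X e K \<longleftrightarrow>
     compact_space K \<and> Hausdorff_space K \<and> embedding_map X K e \<and>
     K closure_of (e ` topspace X) = topspace K"

definition stone_cech :: "'x topology \<Rightarrow> ('x \<Rightarrow> 'b) \<Rightarrow> 'b topology \<Rightarrow> bool" where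
  "stone_cech X e B \<longleftrightarrow>
     compactification X e B \<and>
     (\<forall>f. continuous_map X euclideanreal f \<and> bounded (f ` topspace X) \<longrightarrow>
        (\<exists>g. continuous_map B euclideanreal g \<and> (\<forall>x\<in>topspace X. g (e x) = f x)))"

text \<open>
  The last conjunct says that closures are disjoint iff \<open>d(A,B) > 0\<close>. It is spelled out because
  \<^const>\<open>setdist\<close> is \<open>0\<close>, not infinite, when one of the sets is empty.
\<close>

definition samuel :: "('a::metric_space \<Rightarrow> 'k) \<Rightarrow> 'k topology \<Rightarrow> bool" where
  "samuel i K \<longleftrightarrow>
     compactification euclidean i K \<and>
     (\<forall>f :: 'a \<Rightarrow> real. bounded (range f) \<and> uniformly_continuous_on UNIV f \<longrightarrow>
        (\<exists>g. continuous_map K euclideanreal g \<and> (\<forall>x. g (i x) = f x))) \<and>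
     (\<forall>A B. K closure_of (i ` A) \<inter> K closure_of (i ` B) = {} \<longleftrightarrow>
        (\<exists>\<delta>>0. \<forall>a\<in>A. \<forall>b\<in>B. \<delta> \<le> dist a b))"

text \<open>Only the values on the closure of the image of \<open>e\<close> are determined (for Hausdorff \<open>Y\<close>).\<close>

definition cont_extension ::
  "'x topology \<Rightarrow> ('x \<Rightarrow> 'b) \<Rightarrow> 'b topology \<Rightarrow> 'y topology \<Rightarrow> ('x \<Rightarrow> 'y) \<Rightarrow> 'b \<Rightarrow> 'y" where
  "cont_extension X e B Y f =
     (SOME g. continuous_map B Y g \<and> (\<forall>x\<in>topspace X. g (e x) = f x))"

definition offdiag :: "('a::topological_space \<times> 'a) topology" where
  "offdiag = top_of_set {(x, y). x \<noteq> y}"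

lemma topspace_offdiag [simp]: "topspace offdiag = {(x, y). x \<noteq> y}"
  by (simp add: offdiag_def)

lemma eval_compactification:
  fixes S :: "'x::metric_space set" and F :: "('x \<Rightarrow> real) set"
  assumes cont: "\<forall>f\<in>F. continuous_on S f"
    and bdd: "\<forall>f\<in>F. bounded (f ` S)"
    and sep: "\<And>a. (\<lambda>y. min 1 (dist a y)) \<in> F"
  defines "e \<equiv> (\<lambda>x f. if f \<in> F then f x else 0)"
  defines "C \<equiv> closure (e ` S)"
  shows "compactification (top_of_set S) e (top_of_set C)"
    and "compact C"
    and "\<And>f. f \<in> F \<Longrightarrow> continuous_map (top_of_set C) euclideanreal (\<lambda>p. p f)"
proof -
  have "\<exists>b. \<forall>f x. x \<in> S \<longrightarrow> \<bar>e x f\<bar> \<le> b f"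
  proof -
    have "\<exists>b. \<forall>x\<in>S. \<bar>e x f\<bar> \<le> b" for f
      using bdd by (cases "f \<in> F") (auto simp: e_def bounded_iff)
    then show ?thesis by metis
  qed
  then obtain b where b: "\<And>f x. x \<in> S \<Longrightarrow> \<bar>e x f\<bar> \<le> b f" by blast
  define Q where "Q = (PiE UNIV (\<lambda>f. cball 0 (b f)) :: (('x \<Rightarrow> real) \<Rightarrow> real) set)"
  have cQ: "compactin euclidean Q"
    unfolding euclidean_product_topology[symmetric] Q_def by (simp add: compactin_PiE)
  have haus: "Hausdorff_space (euclidean :: (('x \<Rightarrow> real) \<Rightarrow> real) topology)"
    unfolding euclidean_product_topology[symmetric]
    by (simp add: Hausdorff_space_product_topology)
  have "closedin euclidean Q" using compactin_imp_closedin[OF haus cQ] .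
  then have clQ: "closed Q" by simp
  have "e ` S \<subseteq> Q" using b by (auto simp: Q_def PiE_def)
  then have CQ: "C \<subseteq> Q" unfolding C_def using clQ by (simp add: closure_minimal)
  have "compactin euclidean C"
    by (rule closed_compactin[OF cQ CQ]) (simp add: C_def)
  then show cC: "compact C" by simp
  have ce: "continuous_on S e"
  proof (rule continuous_on_coordinatewise_then_product)
    fix f show "continuous_on S (\<lambda>x. e x f)"
      using cont by (cases "f \<in> F") (auto simp: e_def)
  qed
  have eSC: "e ` S \<subseteq> C" unfolding C_def by (rule closure_subset)
  have inj: "inj_on e S"
  proof (rule inj_onI)
    fix x y assume "e x = e y"
    then have "e x (\<lambda>z. min 1 (dist x z)) = e y (\<lambda>z. min 1 (dist x z))" by simp
    then show "x = y" using sep by (auto simp: e_def min_def split: if_splits)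
  qed
  have om: "open_map (top_of_set S) (top_of_set (e ` S)) e"
    unfolding open_map_def
  proof (intro allI impI)
    fix U assume U: "openin (top_of_set S) U"
    show "openin (top_of_set (e ` S)) (e ` U)"
    proof (subst openin_subopen, rule ballI)
      fix p assume "p \<in> e ` U"
      then obtain x where x: "x \<in> U" "p = e x" by auto
      obtain \<epsilon> where eps: "\<epsilon> > 0" "\<And>y. y \<in> S \<Longrightarrow> dist y x < \<epsilon> \<Longrightarrow> y \<in> U"
        using U x(1) unfolding openin_euclidean_subtopology_iff by blast
      define V where "V = {q :: ('x \<Rightarrow> real) \<Rightarrow> real. q (\<lambda>z. min 1 (dist x z)) < min 1 \<epsilon>}"
      have "open V" unfolding V_def
        by (intro open_Collect_less continuous_on_product_coordinates continuous_on_const)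
      then have "openin (top_of_set (e ` S)) (e ` S \<inter> V)" by (simp add: openin_open_Int)
      moreover have "p \<in> e ` S \<inter> V"
        using x U sep eps(1) openin_imp_subset[OF U] by (auto simp: V_def e_def)
      moreover have "y \<in> U" if y: "y \<in> S" "e y \<in> V" for y
      proof (rule eps(2))
        have "min 1 (dist x y) < min 1 \<epsilon>" using y(2) sep by (simp add: V_def e_def)
        then show "dist y x < \<epsilon>" by (simp add: dist_commute min_def split: if_splits)
      qed (fact y)
      then have "e ` S \<inter> V \<subseteq> e ` U" by blast
      ultimately show "\<exists>T. openin (top_of_set (e ` S)) T \<and> p \<in> T \<and> T \<subseteq> e ` U" by blast
    qed
  qed
  have "embedding_map (top_of_set S) (top_of_set (e ` S)) e"
    by (rule injective_open_imp_embedding_map) (use ce om inj in auto)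
  then have emb: "embedding_map (top_of_set S) (top_of_set C) e"
    using eSC unfolding embedding_map_def
    by (simp add: subtopology_subtopology inf.absorb2)
  show "compactification (top_of_set S) e (top_of_set C)"
    unfolding compactification_def
  proof (intro conjI)
    show "compact_space (top_of_set C)" using cC by (simp add: compact_space_subtopology)
    show "Hausdorff_space (top_of_set C)" using haus by (rule Hausdorff_space_subtopology)
    show "top_of_set C closure_of e ` topspace (top_of_set S) = topspace (top_of_set C)"
      using eSC by (simp add: closure_of_subtopology inf.absorb2 C_def)
  qed (fact emb)
  show "continuous_map (top_of_set C) euclideanreal (\<lambda>p. p f)" if "f \<in> F" for f
    using continuous_on_subset[OF continuous_on_product_coordinates subset_UNIV] by simp
qed

lemma stone_cech_exists:
  fixes S :: "'x::metric_space set"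
  shows "\<exists>e (B :: (('x \<Rightarrow> real) \<Rightarrow> real) topology). stone_cech (top_of_set S) e B"
proof -
  define F where "F = {f :: 'x \<Rightarrow> real. continuous_on S f \<and> bounded (f ` S)}"
  define e where "e = (\<lambda>x f. if f \<in> F then f x else 0)"
  have m: "(\<lambda>y. min 1 (dist a y)) \<in> F" for a
  proof -
    have "continuous_on S (\<lambda>y. min 1 (dist a y))" by (intro continuous_intros)
    moreover have "bounded ((\<lambda>y. min 1 (dist a y)) ` S)"
      unfolding bounded_iff by (rule exI[of _ 1]) auto
    ultimately show ?thesis by (simp add: F_def)
  qed
  have F: "\<forall>f\<in>F. continuous_on S f" "\<forall>f\<in>F. bounded (f ` S)"
    by (auto simp: F_def)
  note E = eval_compactification[OF F m, folded e_def]
  have "stone_cech (top_of_set S) e (top_of_set (closure (e ` S)))"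
    unfolding stone_cech_def
  proof (intro conjI allI impI)
    fix f assume "continuous_map (top_of_set S) euclideanreal f \<and> bounded (f ` topspace (top_of_set S))"
    then have f: "f \<in> F" by (simp add: F_def)
    then show "\<exists>g. continuous_map (top_of_set (closure (e ` S))) euclideanreal g \<and>
           (\<forall>x\<in>topspace (top_of_set S). g (e x) = f x)"
      by (intro exI[of _ "\<lambda>p. p f"]) (use E(3)[OF f] in \<open>auto simp: e_def\<close>)
  qed (fact E(1))
  then show ?thesis by blast
qed

lemma samuel_exists:
  "\<exists>(i :: 'a::metric_space \<Rightarrow> _) (K :: (('a \<Rightarrow> real) \<Rightarrow> real) topology). samuel i K"
proof -
  define F where "F = {f :: 'a \<Rightarrow> real. uniformly_continuous_on UNIV f \<and> bounded (range f)}"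
  define e where "e = (\<lambda>x f. if f \<in> F then f x else 0)"
  define C where "C = closure (range e)"
  have mdist: "(\<lambda>y. min 1 (infdist y A)) \<in> F" for A :: "'a set"
  proof -
    have "uniformly_continuous_on UNIV (\<lambda>y. min 1 (infdist y A))"
    proof (rule lipschitz_on_uniformly_continuous[of 1])
      show "1-lipschitz_on UNIV (\<lambda>y. min 1 (infdist y A))"
      proof (rule lipschitz_onI)
        fix x y
        show "dist (min 1 (infdist x A)) (min 1 (infdist y A)) \<le> 1 * dist x y"
          using infdist_triangle[of x A y] infdist_triangle[of y A x]
          by (auto simp: dist_real_def dist_commute min_def)
      qed simp
    qed
    moreover have "bounded (range (\<lambda>y. min 1 (infdist y A)))"
      unfolding bounded_iff by (rule exI[of _ 1]) (auto simp: infdist_nonneg)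
    ultimately show ?thesis by (simp add: F_def)
  qed
  have m: "(\<lambda>y. min 1 (dist a y)) \<in> F" for a
    using mdist[of "{a}"] by (simp add: dist_commute)
  have F: "\<forall>f\<in>F. continuous_on UNIV f" "\<forall>f\<in>F. bounded (range f)"
    by (auto simp: F_def uniformly_continuous_imp_continuous)
  note E = eval_compactification[OF F m, folded e_def, folded C_def]
  have cl: "top_of_set C closure_of (e ` A) = closure (e ` A)" for A
  proof -
    have "e ` A \<subseteq> range e" by auto
    then have "e ` A \<subseteq> C" unfolding C_def using closure_subset by (rule order_trans)
    moreover have "closure (e ` A) \<subseteq> C" unfolding C_def by (rule closure_mono) auto
    ultimately show ?thesis by (simp add: closure_of_subtopology inf.absorb2)
  qed
  have "samuel e (top_of_set C)"
    unfolding samuel_def cl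
  proof (intro conjI allI impI)
    show "compactification euclidean e (top_of_set C)" using E(1) by simp
  next
    fix f :: "'a \<Rightarrow> real" assume "bounded (range f) \<and> uniformly_continuous_on UNIV f"
    then have f: "f \<in> F" by (simp add: F_def)
    then show "\<exists>g. continuous_map (top_of_set C) euclideanreal g \<and> (\<forall>x. g (e x) = f x)"
      by (intro exI[of _ "\<lambda>p. p f"]) (use E(3)[OF f] in \<open>auto simp: e_def\<close>)
  next
    fix A B :: "'a set"
    show "closure (e ` A) \<inter> closure (e ` B) = {} \<longleftrightarrow> (\<exists>\<delta>>0. \<forall>a\<in>A. \<forall>b\<in>B. \<delta> \<le> dist a b)"
    proof
      assume "\<exists>\<delta>>0. \<forall>a\<in>A. \<forall>b\<in>B. \<delta> \<le> dist a b"
      then obtain \<delta> where d: "\<delta> > 0" "\<And>a b. a \<in> A \<Longrightarrow> b \<in> B \<Longrightarrow> \<delta> \<le> dist a b" by blast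
      show "closure (e ` A) \<inter> closure (e ` B) = {}"
      proof (cases "A = {}")
        case False
        define f where "f = (\<lambda>y. min 1 (infdist y A))"
        have f: "f \<in> F" unfolding f_def by (rule mdist)
        have "closed {p :: ('a \<Rightarrow> real) \<Rightarrow> real. p f \<le> 0}"
          by (intro closed_Collect_le continuous_on_product_coordinates continuous_on_const)
        then have A: "closure (e ` A) \<subseteq> {p. p f \<le> 0}"
          by (rule closure_minimal[rotated]) (use f in \<open>auto simp: e_def f_def\<close>)
        have "closed {p :: ('a \<Rightarrow> real) \<Rightarrow> real. min 1 \<delta> \<le> p f}"
          by (intro closed_Collect_le continuous_on_product_coordinates continuous_on_const)
        moreover have "\<delta> \<le> infdist b A" if "b \<in> B" for b
          unfolding infdist_notempty[OF False]
          by (rule cINF_greatest[OF False]) (use d that in \<open>auto simp: dist_commute\<close>)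
        then have "min 1 \<delta> \<le> f b" if "b \<in> B" for b
          unfolding f_def using that by (intro min.mono) auto
        then have "e ` B \<subseteq> {p. min 1 \<delta> \<le> p f}" using f by (auto simp: e_def)
        ultimately have B: "closure (e ` B) \<subseteq> {p. min 1 \<delta> \<le> p f}"
          by (intro closure_minimal)
        have "min 1 \<delta> > 0" using d by simp
        then show ?thesis using A B by fastforce
      qed simp
    next
      assume disj: "closure (e ` A) \<inter> closure (e ` B) = {}"
      show "\<exists>\<delta>>0. \<forall>a\<in>A. \<forall>b\<in>B. \<delta> \<le> dist a b"
      proof (rule ccontr)
        assume neg: "\<not> ?thesis"
        have "\<exists>a b. a \<in> A \<and> b \<in> B \<and> dist a b < inverse (real (Suc n))" for n
        proof -
          have "inverse (real (Suc n)) > 0" by simp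
          with neg show ?thesis by (meson not_le)
        qed
        then obtain a b where ab: "\<And>n. a n \<in> A" "\<And>n. b n \<in> B"
          "\<And>n. dist (a n) (b n) < inverse (real (Suc n))" by metis
        have C': "e x \<in> C" for x unfolding C_def using closure_subset rangeI by (rule subsetD)
        have "filtermap (\<lambda>n. e (a n)) sequentially \<noteq> bot" by (simp add: filtermap_bot_iff)
        moreover have "eventually (\<lambda>p. p \<in> C) (filtermap (\<lambda>n. e (a n)) sequentially)"
          using C' by (simp add: eventually_filtermap)
        ultimately obtain x where x: "inf (nhds x) (filtermap (\<lambda>n. e (a n)) sequentially) \<noteq> bot"
          using E(2)[unfolded compact_filter] by blast
        define G where "G = inf (filtercomap (\<lambda>n. e (a n)) (nhds x)) sequentially"
        have G: "G \<noteq> bot"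
        proof
          assume "G = bot"
          then have "eventually (\<lambda>_. False) G" by simp
          then obtain P Q where PQ: "eventually P (filtercomap (\<lambda>n. e (a n)) (nhds x))"
            "eventually Q sequentially" "\<And>n. P n \<and> Q n \<Longrightarrow> False"
            unfolding G_def eventually_inf by blast
          obtain R where R: "eventually R (nhds x)" "\<And>n. R (e (a n)) \<Longrightarrow> P n"
            using PQ(1) unfolding eventually_filtercomap by blast
          have "eventually (\<lambda>p. \<not> R p) (filtermap (\<lambda>n. e (a n)) sequentially)"
            unfolding eventually_filtermap using PQ(2) by eventually_elim (use PQ(3) R(2) in blast)
          with R(1) have "eventually (\<lambda>_. False) (inf (nhds x) (filtermap (\<lambda>n. e (a n)) sequentially))"
            unfolding eventually_inf by blast
          with x show False by (simp add: trivial_limit_def)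
        qed
        have ta: "((\<lambda>n. e (a n)) \<longlongrightarrow> x) G"
          unfolding filterlim_def G_def
          by (metis filtermap_filtercomap filtermap_mono inf_le1 order_trans)
        have "limitin (product_topology (\<lambda>_. euclidean) UNIV) (\<lambda>n. e (a n)) x G"
          using ta by (simp add: euclidean_product_topology)
        then have coord: "((\<lambda>n. e (a n) f) \<longlongrightarrow> x f) G" for f
          by (simp add: limitin_componentwise)
        have diff: "((\<lambda>n. e (b n) f - e (a n) f) \<longlongrightarrow> 0) G" for f
        proof (cases "f \<in> F")
          case True
          then have uc: "uniformly_continuous_on UNIV f" by (simp add: F_def)
          have "((\<lambda>n. e (b n) f - e (a n) f) \<longlongrightarrow> 0) sequentially"
          proof (rule LIMSEQ_I)
            fix r :: real assume "r > 0"
            then obtain d where d: "d > 0" "\<And>x y. dist x y < d \<Longrightarrow> dist (f x) (f y) < r"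
              using uc unfolding uniformly_continuous_on_def by (metis UNIV_I)
            obtain N where N: "inverse (real (Suc N)) < d" using reals_Archimedean[OF d(1)] by blast
            show "\<exists>no. \<forall>n\<ge>no. norm (e (b n) f - e (a n) f - 0) < r"
            proof (intro exI allI impI)
              fix n assume "N \<le> n"
              then have "inverse (real (Suc n)) \<le> inverse (real (Suc N))" by (simp add: field_simps)
              with N ab(3)[of n] have "dist (a n) (b n) < d" by linarith
              then have "dist (b n) (a n) < d" by (simp add: dist_commute)
              from d(2)[OF this] show "norm (e (b n) f - e (a n) f - 0) < r"
                using True by (simp add: e_def dist_real_def)
            qed
          qed
          then show ?thesis by (rule tendsto_mono[rotated]) (simp add: G_def)
        qed (simp add: e_def)
        have coordb: "((\<lambda>n. e (b n) f) \<longlongrightarrow> x f) G" for f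
          using tendsto_add[OF coord[of f] diff[of f]] by simp
        have "limitin (product_topology (\<lambda>_. euclidean) UNIV) (\<lambda>n. e (b n)) x G"
          using coordb by (simp add: limitin_componentwise)
        then have tb: "((\<lambda>n. e (b n)) \<longlongrightarrow> x) G"
          by (simp add: euclidean_product_topology)
        have "x \<in> closure (e ` A)"
          by (rule Lim_in_closed_set[OF _ _ G ta])
            (auto intro!: always_eventually subsetD[OF closure_subset] imageI ab)
        moreover have "x \<in> closure (e ` B)"
          by (rule Lim_in_closed_set[OF _ _ G tb])
            (auto intro!: always_eventually subsetD[OF closure_subset] imageI ab)
        ultimately show False using disj by blast
      qed
    qed
  qed
  then show ?thesis by blast
qed

section \<open>Radon measures on the Stone-Cech compactification\<close>

definition borel_of :: "'b topology \<Rightarrow> 'b measure" where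
  "borel_of B = sigma (topspace B) {U. openin B U}"

text \<open>
  These are the nonnegative elements of the space of signed Radon measures; the total variation norm of
  such a measure is its total mass.
\<close>

definition pos_radon_measures :: "'b topology \<Rightarrow> 'b measure set" where
  "pos_radon_measures B =
     {\<mu>. sets \<mu> = sets (borel_of B) \<and> finite_measure \<mu> \<and>
         (\<forall>E\<in>sets \<mu>. emeasure \<mu> E = (SUP K\<in>{K. compactin B K \<and> K \<subseteq> E}. emeasure \<mu> K))}"

definition msupp :: "'b topology \<Rightarrow> 'b measure \<Rightarrow> 'b set" where
  "msupp B \<mu> = {x \<in> topspace B. \<forall>U. openin B U \<and> x \<in> U \<longrightarrow> emeasure \<mu> U > 0}"

definition Phi ::
  "('a \<times> 'a \<Rightarrow> 'b) \<Rightarrow> 'b topology \<Rightarrow> 'a::{metric_space, zero} lip0 \<Rightarrow> 'b \<Rightarrow> real" where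
  "Phi e B f =
     cont_extension offdiag e B euclideanreal (\<lambda>(x, y). (lip_fun f x - lip_fun f y) / dist x y)"

definition Phi_adj ::
  "('a \<times> 'a \<Rightarrow> 'b) \<Rightarrow> 'b topology \<Rightarrow> 'b measure \<Rightarrow> 'a::{metric_space, zero} lip0 \<Rightarrow>\<^sub>L real" where
  "Phi_adj e B \<mu> = Blinfun (\<lambda>f. \<integral>\<xi>. Phi e B f \<xi> \<partial>\<mu>)"

text \<open>The Bochner integral is a bounded functional of \<open>f\<close> here; see \<open>Phi_adj_apply\<close> below.\<close>

definition M_op ::
  "('a::{metric_space, zero} \<times> 'a \<Rightarrow> 'b) \<Rightarrow> 'b topology \<Rightarrow> 'b measure set" where
  "M_op e B = {\<mu> \<in> pos_radon_measures B. measure \<mu> (space \<mu>) = norm (Phi_adj e B \<mu>)}"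

lemma Phi_works:
  fixes f :: "'a::{metric_space, zero} lip0"
  assumes "stone_cech offdiag e B"
  shows "continuous_map B euclideanreal (Phi e B f)"
    and "x \<noteq> y \<Longrightarrow> Phi e B f (e (x, y)) = (lip_fun f x - lip_fun f y) / dist x y"
    and "\<xi> \<in> topspace B \<Longrightarrow> \<bar>Phi e B f \<xi>\<bar> \<le> norm f"
proof -
  define q where "q = (\<lambda>(x, y). (lip_fun f x - lip_fun f y) / dist x y)"
  have L: "(norm f)-lipschitz_on UNIV (lip_fun f)" by (rule norm_lip0_lipschitz)
  have "continuous_on UNIV (lip_fun f)" using L by (rule lipschitz_on_continuous_on)
  then have c: "continuous_on X (\<lambda>z. lip_fun f (g z))" if "continuous_on X g"
    for g :: "'a \<times> 'a \<Rightarrow> 'a" and X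
    using that by (rule continuous_on_compose2) auto
  have "continuous_on {(x, y). x \<noteq> y} q"
    unfolding q_def case_prod_unfold
    by (intro continuous_intros c) auto
  then have cq: "continuous_map offdiag euclideanreal q"
    by (simp add: offdiag_def)
  have bq: "\<bar>q (x, y)\<bar> \<le> norm f" if "x \<noteq> y" for x y
    using lipschitz_onD[OF L, of x y] that by (simp add: q_def dist_real_def abs_divide field_simps)
  then have "bounded (q ` topspace offdiag)"
    by (auto simp: bounded_iff)
  with assms cq have "\<exists>g. continuous_map B euclideanreal g \<and> (\<forall>z\<in>topspace offdiag. g (e z) = q z)"
    unfolding stone_cech_def by blast
  then have *: "continuous_map B euclideanreal (Phi e B f) \<and>
      (\<forall>z\<in>topspace offdiag. Phi e B f (e z) = q z)"
    unfolding Phi_def cont_extension_def q_def by (rule someI_ex)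
  then show c: "continuous_map B euclideanreal (Phi e B f)" by blast
  show v: "x \<noteq> y \<Longrightarrow> Phi e B f (e (x, y)) = (lip_fun f x - lip_fun f y) / dist x y" for x y
    using * by (auto simp: q_def)
  assume "\<xi> \<in> topspace B"
  then have "\<xi> \<in> B closure_of (e ` topspace offdiag)"
    using assms by (auto simp: stone_cech_def compactification_def)
  then have "Phi e B f \<xi> \<in> cball 0 (norm f)"
  proof (rule forall_in_closure_of)
    show "closedin B {x \<in> topspace B. Phi e B f x \<in> cball 0 (norm f)}"
      by (rule closedin_continuous_map_preimage[OF c]) simp
    show "Phi e B f x \<in> cball 0 (norm f)" if "x \<in> e ` topspace offdiag" for x
      using that * bq by auto
  qed
  then show "\<bar>Phi e B f \<xi>\<bar> \<le> norm f" by simp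
qed

lemma Phi_adj_apply:
  fixes f :: "'a::{metric_space, zero} lip0"
  assumes sc: "stone_cech offdiag e B" and \<mu>: "\<mu> \<in> pos_radon_measures B"
  shows "blinfun_apply (Phi_adj e B \<mu>) f = (\<integral>\<xi>. Phi e B f \<xi> \<partial>\<mu>)"
proof -
  have sets: "sets \<mu> = sets (borel_of B)" and "finite_measure \<mu>"
    using \<mu> by (auto simp: pos_radon_measures_def)
  interpret finite_measure \<mu> by fact
  have sp: "space \<mu> = topspace B"
    using sets_eq_imp_space_eq[OF sets] openin_subset
    by (auto simp: borel_of_def space_measure_of_conv)
  have meas: "Phi e B f \<in> borel_measurable \<mu>" for f
  proof (rule borel_measurableI)
    fix S :: "real set" assume "open S"
    then have "openin B {x \<in> topspace B. Phi e B f x \<in> S}"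
      using openin_continuous_map_preimage[OF Phi_works(1)[OF sc]] by simp
    moreover have "Phi e B f -` S \<inter> space \<mu> = {x \<in> topspace B. Phi e B f x \<in> S}"
      using sp by auto
    ultimately show "Phi e B f -` S \<inter> space \<mu> \<in> sets \<mu>"
      unfolding sets borel_of_def by (auto simp: sets_measure_of_conv dest: openin_subset)
  qed
  have int: "integrable \<mu> (Phi e B f)" for f
    by (rule integrable_const_bound[OF _ meas, of _ "norm f"])
      (use Phi_works(3)[OF sc] sp in \<open>auto intro!: AE_I2\<close>)
  have eq: "g \<xi> = k \<xi>" if "\<xi> \<in> space \<mu>" "continuous_map B euclideanreal g"
      "continuous_map B euclideanreal k" "\<And>x y. x \<noteq> y \<Longrightarrow> g (e (x, y)) = k (e (x, y))" for g k \<xi>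
  proof -
    have "\<xi> \<in> B closure_of (e ` topspace offdiag)"
      using sc sp that(1) by (auto simp: stone_cech_def compactification_def)
    then show ?thesis
      by (rule forall_in_closure_of_eq[where Y = euclideanreal]) (use that in auto)
  qed
  have "bounded_linear (\<lambda>f. \<integral>\<xi>. Phi e B f \<xi> \<partial>\<mu>)"
  proof (rule bounded_linear_intro)
    fix f g :: "'a lip0" and r :: real
    have "(\<integral>\<xi>. Phi e B (f + g) \<xi> \<partial>\<mu>) = (\<integral>\<xi>. Phi e B f \<xi> + Phi e B g \<xi> \<partial>\<mu>)"
      by (rule Bochner_Integration.integral_cong[OF refl], rule eq)
        (auto intro!: Phi_works[OF sc] continuous_intros
          simp: Phi_works(2)[OF sc] plus_lip0.rep_eq diff_divide_distrib add_divide_distrib)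
    then show "(\<integral>\<xi>. Phi e B (f + g) \<xi> \<partial>\<mu>) = (\<integral>\<xi>. Phi e B f \<xi> \<partial>\<mu>) + (\<integral>\<xi>. Phi e B g \<xi> \<partial>\<mu>)"
      using int by simp
    have "(\<integral>\<xi>. Phi e B (r *\<^sub>R f) \<xi> \<partial>\<mu>) = (\<integral>\<xi>. r * Phi e B f \<xi> \<partial>\<mu>)"
      by (rule Bochner_Integration.integral_cong[OF refl], rule eq)
        (auto intro!: Phi_works[OF sc] continuous_map_real_mult_left
          simp: Phi_works(2)[OF sc] scaleR_lip0.rep_eq right_diff_distrib diff_divide_distrib)
    then show "(\<integral>\<xi>. Phi e B (r *\<^sub>R f) \<xi> \<partial>\<mu>) = r *\<^sub>R (\<integral>\<xi>. Phi e B f \<xi> \<partial>\<mu>)"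
      by simp
    have "norm (\<integral>\<xi>. Phi e B f \<xi> \<partial>\<mu>) \<le> (\<integral>\<xi>. norm (Phi e B f \<xi>) \<partial>\<mu>)"
      by (rule integral_norm_bound)
    also have "\<dots> \<le> (\<integral>\<xi>. norm f \<partial>\<mu>)"
      by (rule integral_mono) (use int Phi_works(3)[OF sc] sp in auto)
    also have "\<dots> = norm f * measure \<mu> (space \<mu>)" by simp
    finally show "norm (\<integral>\<xi>. Phi e B f \<xi> \<partial>\<mu>) \<le> norm f * measure \<mu> (space \<mu>)" .
  qed
  then show ?thesis unfolding Phi_adj_def by (simp add: bounded_linear_Blinfun_apply)
qed

section \<open>Shadows and extended supports\<close>

definition shadow ::
  "('a::topological_space \<times> 'a \<Rightarrow> 'b) \<Rightarrow> 'b topology \<Rightarrow> ('a \<Rightarrow> 'k) \<Rightarrow> 'k topology \<Rightarrow> 'b set \<Rightarrow> 'k set"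
  where
  "shadow e B i K E =
     cont_extension offdiag e B K (\<lambda>(x, y). i x) ` E \<union>
     cont_extension offdiag e B K (\<lambda>(x, y). i y) ` E"

definition ext_support ::
  "('a \<Rightarrow> 'k) \<Rightarrow> 'k topology \<Rightarrow> ('a::{metric_space, zero} lip0 \<Rightarrow>\<^sub>L real) \<Rightarrow> 'k set" where
  "ext_support i K \<phi> =
     \<Inter> {K closure_of (i ` A) | A.
          \<forall>f. (\<forall>x\<in>A. lip_fun f x = 0) \<longrightarrow> blinfun_apply \<phi> f = 0}"

end

theory Submission
  imports Defs
begin

text \<open>
  Let \<open>T\<close> be the extended support of \<open>\<phi>\<close> together with the base point, and let \<open>E\<close> be the closed set of
  points of \<open>\<beta>M~\<close> both of whose coordinates lie in \<open>T\<close>. Because \<open>\<phi>\<close> avoids infinity, its value at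
  \<open>f\<close> depends only on the restriction of \<open>f\<close> to any given neighbourhood of \<open>T\<close>, so McShane extension
  and compactness give \<open>\<phi>(f) \<le> \<parallel>\<phi>\<parallel> max(0, sup\<^sub>E \<Phi>f)\<close>. The right-hand side is sublinear in
  \<open>\<Phi>f\<close>, and any linear functional on \<open>C(\<beta>M~)\<close> dominated by it is positive, has mass at most \<open>\<parallel>\<phi>\<parallel>\<close>
  and lives on \<open>E\<close>. Hahn--Banach and Riesz--Markov thus yield an optimal measure whose shadow is
  inside \<open>T\<close>. Conversely, if \<open>f\<close> vanishes near the shadow of the support of a representing measure,
  then \<open>\<Phi>f\<close> vanishes on that support and \<open>\<phi>(f) = 0\<close>; so the shadow contains the extended support.
\<close>

section \<open>Lipschitz extension\<close>

text \<open>The obstacle is that the extended support is an intersection of closures of sets that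
  determine \<phi>, while the domination needs one determining set near it. Two determining sets are
  combined by gluing f on one with 0 on the other, but the glued function need not be Lipschitz
  unless f is bounded: outside a neighbourhood of the common closure the sets are merely some
  \<delta> > 0 apart. Cutting f off with h_n makes it bounded, and avoiding infinity lets the
  cutoffs be removed. Finite intersections follow by induction, arbitrary ones by compactness of the
  Samuel compactification. The base point enters because a McShane extension belongs to
  \<open>lip0\<close> only if it vanishes at 0, so 0 has to lie in the set from which f is extended.
  The maximum with 0 fixes the value of the supremum when E is empty, as happens if \<phi> = 0 and
  the base point is isolated. Optimality then costs nothing: the adjoint of \<Phi> does not increase
  norms, so a mass of at most the norm of \<phi> must equal it.\<close>

lemma mcshane_extension:
  fixes g :: "'a::metric_space \<Rightarrow> real"
  assumes g: "L-lipschitz_on S g" and "S \<noteq> {}"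
  obtains h where "L-lipschitz_on UNIV h" "\<And>x. x \<in> S \<Longrightarrow> h x = g x"
proof
  \<comment> \<open>The infimum of the upper cones of slope L with apex on the graph of g; this is
    the largest L-Lipschitz extension.\<close>
  define h where "h x = (INF y\<in>S. g y + L * dist x y)" for x
  have L: "0 \<le> L" using g by (rule lipschitz_on_nonneg)
  have *: "g x - g y \<le> L * dist x y" if "x \<in> S" "y \<in> S" for x y
    using lipschitz_onD[OF g that] by (simp add: dist_real_def)
  have bdd: "bdd_below ((\<lambda>y. g y + L * dist x y) ` S)" for x
  proof -
    obtain s where s: "s \<in> S" using \<open>S \<noteq> {}\<close> by blast
    show ?thesis
    proof (rule bdd_belowI2)
      fix y assume y: "y \<in> S"
      have "L * dist s y \<le> L * (dist x s + dist x y)"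
        using L dist_triangle3[of s y x] by (intro mult_left_mono) auto
      with *[OF s y] show "g s - L * dist x s \<le> g y + L * dist x y"
        by (simp add: algebra_simps)
    qed
  qed
  have le: "h x \<le> h y + L * dist x y" for x y
  proof -
    have "h x - L * dist x y \<le> h y"
      unfolding h_def[of y]
    proof (rule cINF_greatest[OF \<open>S \<noteq> {}\<close>])
      fix z assume z: "z \<in> S"
      have "h x \<le> g z + L * dist x z"
        unfolding h_def by (rule cINF_lower[OF bdd z])
      moreover have "L * dist x z \<le> L * (dist x y + dist y z)"
        using L by (intro mult_left_mono dist_triangle)
      ultimately show "h x - L * dist x y \<le> g z + L * dist y z"
        by (simp add: algebra_simps)
    qed
    then show ?thesis by simp
  qed
  show "L-lipschitz_on UNIV h"
  proof (rule lipschitz_onI[OF _ L])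
    fix x y show "dist (h x) (h y) \<le> L * dist x y"
      using le[of x y] le[of y x] by (simp add: dist_real_def dist_commute abs_le_iff)
  qed
  show "h x = g x" if "x \<in> S" for x
  proof (rule antisym)
    show "h x \<le> g x"
      unfolding h_def by (rule cINF_lower2[OF bdd that]) simp
    show "g x \<le> h x"
      unfolding h_def using *[OF that] by (intro cINF_greatest[OF \<open>S \<noteq> {}\<close>]) force
  qed
qed


lemma lip_fun_0 [simp]: "lip_fun f 0 = 0"
  using lip_fun[of f] by simp

lemma lip0_extension:
  fixes g :: "'a::{metric_space, zero} \<Rightarrow> real"
  assumes "L-lipschitz_on S g" "0 \<in> S" "g 0 = 0"
  obtains h :: "'a lip0" where "norm h \<le> L" "\<And>x. x \<in> S \<Longrightarrow> lip_fun h x = g x"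
proof -
  obtain k where k: "L-lipschitz_on UNIV k" "\<And>x. x \<in> S \<Longrightarrow> k x = g x"
    using mcshane_extension[OF assms(1)] assms(2) by blast
  then have "lip_fun (Lip0 k) = k"
    using assms by (intro Lip0_inverse) auto
  then show thesis using that[of "Lip0 k"] k norm_lip0_le[of L "Lip0 k"] by simp
qed

section \<open>Hahn--Banach by minimal sublinear functionals\<close>

definition lin_closed :: "('c \<Rightarrow> real) set \<Rightarrow> bool" where
  "lin_closed V \<longleftrightarrow> V \<noteq> {} \<and> (\<forall>g\<in>V. \<forall>h\<in>V. (\<lambda>x. g x + h x) \<in> V) \<and> (\<forall>g\<in>V. \<forall>c. (\<lambda>x. c * g x) \<in> V)"

text \<open>Functionals are total on functions, so their values off V are unconstrained and
  comparisons have to be restricted to V.\<close>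

definition sublinear_on :: "('c \<Rightarrow> real) set \<Rightarrow> (('c \<Rightarrow> real) \<Rightarrow> real) \<Rightarrow> bool" where
  "sublinear_on V p \<longleftrightarrow>
     (\<forall>g\<in>V. \<forall>h\<in>V. p (\<lambda>x. g x + h x) \<le> p g + p h) \<and>
     (\<forall>g\<in>V. \<forall>c\<ge>0. p (\<lambda>x. c * g x) = c * p g)"

lemma
  assumes "lin_closed V"
  shows lin_closed_add: "g \<in> V \<Longrightarrow> h \<in> V \<Longrightarrow> (\<lambda>x. g x + h x) \<in> V"
    and lin_closed_cmult: "g \<in> V \<Longrightarrow> (\<lambda>x. c * g x) \<in> V"
    and lin_closed_uminus: "g \<in> V \<Longrightarrow> (\<lambda>x. - g x) \<in> V"
    and lin_closed_diff: "g \<in> V \<Longrightarrow> h \<in> V \<Longrightarrow> (\<lambda>x. g x - h x) \<in> V"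
    and lin_closed_zero: "(\<lambda>x. 0) \<in> V"
proof -
  show a: "g \<in> V \<Longrightarrow> h \<in> V \<Longrightarrow> (\<lambda>x. g x + h x) \<in> V" for g h
    using assms by (simp add: lin_closed_def)
  show c: "g \<in> V \<Longrightarrow> (\<lambda>x. c * g x) \<in> V" for g c
    using assms by (simp add: lin_closed_def)
  show u: "g \<in> V \<Longrightarrow> (\<lambda>x. - g x) \<in> V" for g
    using c[of g "-1"] by simp
  show "g \<in> V \<Longrightarrow> h \<in> V \<Longrightarrow> (\<lambda>x. g x - h x) \<in> V"
    using a[OF _ u, of g h] by simp
  obtain g where "g \<in> V" using assms by (auto simp: lin_closed_def)
  from c[OF this, of 0] show "(\<lambda>x. 0) \<in> V" by simp
qed

lemma
  assumes "sublinear_on V p"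
  shows sublinear_on_add: "g \<in> V \<Longrightarrow> h \<in> V \<Longrightarrow> p (\<lambda>x. g x + h x) \<le> p g + p h"
    and sublinear_on_cmult: "g \<in> V \<Longrightarrow> c \<ge> 0 \<Longrightarrow> p (\<lambda>x. c * g x) = c * p g"
  using assms by (simp_all add: sublinear_on_def)

lemma sublinear_on_zero:
  assumes "lin_closed V" "sublinear_on V p"
  shows "p (\<lambda>x. 0) = 0"
  using sublinear_on_cmult[OF assms(2) lin_closed_zero[OF assms(1)], of 0] by simp

lemma sublinear_on_uminus:
  assumes "lin_closed V" "sublinear_on V p" "g \<in> V"
  shows "- p (\<lambda>x. - g x) \<le> p g"
  using sublinear_on_add[OF assms(2) assms(3) lin_closed_uminus[OF assms(1,3)]]
    sublinear_on_zero[OF assms(1,2)] by simp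

text \<open>Serves three infima: over a chain, along a direction h, and over the domain of T. Each
  needs only one index r that does as well as the given ones. Homogeneity as an equality follows
  from the inequality for c and for 1/c; the value at 0 is 0 because it is at most 0 and at most
  twice itself.\<close>

lemma sublinear_on_INF:
  fixes q :: "'d \<Rightarrow> ('c \<Rightarrow> real) \<Rightarrow> real"
  assumes V: "lin_closed V"
    and ne: "I \<noteq> {}"
    and bdd: "\<And>g. g \<in> V \<Longrightarrow> bdd_below ((\<lambda>t. q t g) ` I)"
    and add: "\<And>g h s t. g \<in> V \<Longrightarrow> h \<in> V \<Longrightarrow> s \<in> I \<Longrightarrow> t \<in> I \<Longrightarrow>
                \<exists>r\<in>I. q r (\<lambda>x. g x + h x) \<le> q s g + q t h"
    and scale: "\<And>g c t. g \<in> V \<Longrightarrow> c > 0 \<Longrightarrow> t \<in> I \<Longrightarrow> \<exists>r\<in>I. q r (\<lambda>x. c * g x) \<le> c * q t g"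
    and zero: "\<exists>r\<in>I. q r (\<lambda>x. 0) \<le> 0"
  shows "sublinear_on V (\<lambda>g. INF t\<in>I. q t g)"
proof -
  let ?p = "\<lambda>g. INF t\<in>I. q t g"
  have lower: "?p g \<le> q t g" if "g \<in> V" "t \<in> I" for g t
    by (rule cINF_lower[OF bdd[OF that(1)] that(2)])
  have add': "?p (\<lambda>x. g x + h x) \<le> ?p g + ?p h" if "g \<in> V" "h \<in> V" for g h
  proof -
    have 1: "?p (\<lambda>x. g x + h x) \<le> q s g + q t h" if "s \<in> I" "t \<in> I" for s t
      using add[OF \<open>g \<in> V\<close> \<open>h \<in> V\<close> that] lower[OF lin_closed_add[OF V \<open>g \<in> V\<close> \<open>h \<in> V\<close>]]
      by (meson order_trans)
    have 2: "?p (\<lambda>x. g x + h x) - q s g \<le> ?p h" if "s \<in> I" for s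
      by (rule cINF_greatest[OF ne]) (use 1[OF that] in \<open>simp add: algebra_simps\<close>)
    have "?p (\<lambda>x. g x + h x) - ?p h \<le> ?p g"
      by (rule cINF_greatest[OF ne]) (use 2 in \<open>simp add: algebra_simps\<close>)
    then show ?thesis by simp
  qed
  have le: "?p (\<lambda>x. c * g x) \<le> c * ?p g" if "g \<in> V" "c > 0" for g and c :: real
  proof -
    have "?p (\<lambda>x. c * g x) / c \<le> ?p g"
    proof (rule cINF_greatest[OF ne])
      fix t assume "t \<in> I"
      from scale[OF that this] lower[OF lin_closed_cmult[OF V that(1)]]
      have "?p (\<lambda>x. c * g x) \<le> c * q t g" by (meson order_trans)
      with that show "?p (\<lambda>x. c * g x) / c \<le> q t g" by (simp add: field_simps)
    qed
    with that show ?thesis by (simp add: field_simps)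
  qed
  have eq: "?p (\<lambda>x. c * g x) = c * ?p g" if g: "g \<in> V" and c: "c > 0" for g and c :: real
  proof (rule antisym[OF le[OF that]])
    have "?p (\<lambda>x. inverse c * (c * g x)) \<le> inverse c * ?p (\<lambda>x. c * g x)"
      using c by (intro le lin_closed_cmult[OF V g]) auto
    then show "c * ?p g \<le> ?p (\<lambda>x. c * g x)"
      using c by (simp add: field_simps)
  qed
  have 0: "?p (\<lambda>x. 0) = 0"
  proof -
    have "?p (\<lambda>x. 0) \<le> 0"
      using zero lower[OF lin_closed_zero[OF V]] by (meson order_trans)
    moreover have "?p (\<lambda>x. 0) \<le> ?p (\<lambda>x. 0) + ?p (\<lambda>x. 0)"
      using add'[OF lin_closed_zero[OF V] lin_closed_zero[OF V]] by simp
    ultimately show ?thesis by linarith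
  qed
  show ?thesis
    unfolding sublinear_on_def
  proof (intro conjI ballI allI impI)
    fix g and c :: real assume "g \<in> V" "0 \<le> c"
    then show "?p (\<lambda>x. c * g x) = c * ?p g"
      using eq 0 by (cases "c = 0") auto
  qed (rule add')
qed

lemma minimal_sublinear_exists:
  assumes V: "lin_closed V" and p: "sublinear_on V p"
  obtains q where "sublinear_on V q" "\<And>g. g \<in> V \<Longrightarrow> q g \<le> p g"
    "\<And>r g. sublinear_on V r \<Longrightarrow> (\<And>h. h \<in> V \<Longrightarrow> r h \<le> q h) \<Longrightarrow> g \<in> V \<Longrightarrow> r g = q g"
proof -
  \<comment> \<open>Fixing the value 0 off V makes the pointwise order of total functionals a
    comparison on V alone.\<close>
  define A where
    "A = {q. sublinear_on V q \<and> (\<forall>g\<in>V. q g \<le> p g) \<and> (\<forall>g. g \<notin> V \<longrightarrow> q g = 0)}"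
  have restrict: "(\<lambda>g. if g \<in> V then q g else 0) \<in> A"
    if "sublinear_on V q" "\<And>g. g \<in> V \<Longrightarrow> q g \<le> p g" for q
  proof -
    let ?r = "\<lambda>g. if g \<in> V then q g else 0"
    have "?r (\<lambda>x. g x + h x) \<le> ?r g + ?r h" if "g \<in> V" "h \<in> V" for g h
      using sublinear_on_add[OF \<open>sublinear_on V q\<close> that] lin_closed_add[OF V that] that by presburger
    moreover have "?r (\<lambda>x. c * g x) = c * ?r g" if "g \<in> V" "c \<ge> 0" for g c
      using sublinear_on_cmult[OF \<open>sublinear_on V q\<close> that] lin_closed_cmult[OF V that(1)] that(1) by presburger
    ultimately have "sublinear_on V ?r" unfolding sublinear_on_def by blast
    then show ?thesis using that(2) by (simp add: A_def)
  qed
  have "\<exists>m\<in>A. \<forall>a\<in>A. a \<le> m \<longrightarrow> a = m"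
  proof (rule predicate_Zorn[where P = "\<lambda>q r. r \<le> q"])
    show "partial_order_on A (relation_of (\<lambda>q r. r \<le> q) A)"
      by (auto simp: partial_order_on_def preorder_on_def refl_on_def trans_def antisym_def
          relation_of_def)
  next
    fix C assume C: "C \<in> Chains (relation_of (\<lambda>q r. r \<le> q) A)"
    then have *: "\<forall>q\<in>C. \<forall>r\<in>C. (q \<in> A \<and> r \<in> A \<and> r \<le> q) \<or> (r \<in> A \<and> q \<in> A \<and> q \<le> r)"
      by (simp add: Chains_def relation_of_def)
    then have CA: "C \<subseteq> A" and tot: "\<And>q r. q \<in> C \<Longrightarrow> r \<in> C \<Longrightarrow> q \<le> r \<or> r \<le> q"
      by blast+
    show "\<exists>u\<in>A. \<forall>a\<in>C. u \<le> a"
    proof (cases "C = {}")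
      case True
      then show ?thesis using restrict[OF p order_refl] by blast
    next
      case False
      \<comment> \<open>Sublinearity of q gives -q(-g) \<le> q(g), and q \<le> p at -g bounds this
        below by -p(-g), uniformly along the chain.\<close>
      have bdd: "bdd_below ((\<lambda>q. q g) ` C)" if "g \<in> V" for g
      proof (rule bdd_belowI2)
        fix q assume "q \<in> C"
        then have q: "sublinear_on V q" "\<And>g. g \<in> V \<Longrightarrow> q g \<le> p g"
          using CA by (auto simp: A_def)
        show "- p (\<lambda>x. - g x) \<le> q g"
          using sublinear_on_uminus[OF V q(1) that] q(2)[OF lin_closed_uminus[OF V that]] by linarith
      qed
      have sub: "\<And>q. q \<in> C \<Longrightarrow> sublinear_on V q" using CA by (auto simp: A_def)
      define u where "u g = (INF q\<in>C. q g)" for g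
      have "sublinear_on V u"
        unfolding u_def
      proof (rule sublinear_on_INF[OF V False bdd])
        fix g h s t assume *: "g \<in> V" "h \<in> V" "s \<in> C" "t \<in> C"
        then obtain r where r: "r \<in> C" "r \<le> s" "r \<le> t" using tot by blast
        then have "r (\<lambda>x. g x + h x) \<le> s g + t h"
          using sublinear_on_add[OF sub[OF r(1)] *(1,2)] le_funD[OF r(2), of g] le_funD[OF r(3), of h]
          by linarith
        then show "\<exists>r\<in>C. r (\<lambda>x. g x + h x) \<le> s g + t h" using r by blast
      next
        fix g t and c :: real assume "g \<in> V" "c > 0" "t \<in> C"
        then show "\<exists>r\<in>C. r (\<lambda>x. c * g x) \<le> c * t g"
          using sublinear_on_cmult[OF sub[OF \<open>t \<in> C\<close>] \<open>g \<in> V\<close>, of c] by (intro bexI[of _ t]) simp_all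
      next
        show "\<exists>r\<in>C. r (\<lambda>x. 0) \<le> 0"
        proof -
          obtain r where "r \<in> C" using False by blast
          then show ?thesis using sublinear_on_zero[OF V sub[OF \<open>r \<in> C\<close>]] by (intro bexI[of _ r]) simp_all
        qed
      qed
      moreover have le: "u g \<le> q g" if "g \<in> V" "q \<in> C" for g q
        unfolding u_def by (rule cINF_lower[OF bdd[OF that(1)] that(2)])
      moreover have "u g \<le> p g" if "g \<in> V" for g
      proof -
        obtain q where "q \<in> C" using False by blast
        then have "q g \<le> p g" using CA that by (auto simp: A_def)
        with le[OF that \<open>q \<in> C\<close>] show ?thesis by simp
      qed
      ultimately have "(\<lambda>g. if g \<in> V then u g else 0) \<in> A" by (intro restrict)
      then show ?thesis
      proof (rule rev_bexI, intro ballI le_funI)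
        fix q g assume q: "q \<in> C"
        show "(if g \<in> V then u g else 0) \<le> q g"
        proof (cases "g \<in> V")
          case False
          moreover have "q \<in> A" using q CA by blast
          ultimately show ?thesis by (simp add: A_def)
        qed (use le q in simp)
      qed
    qed
  qed
  then obtain q where q: "q \<in> A" "\<And>r. r \<in> A \<Longrightarrow> r \<le> q \<Longrightarrow> r = q" by blast
  show thesis
  proof
    show q1: "sublinear_on V q" "\<And>g. g \<in> V \<Longrightarrow> q g \<le> p g" using q(1) by (auto simp: A_def)
    fix r g assume r: "sublinear_on V r" "\<And>h. h \<in> V \<Longrightarrow> r h \<le> q h" and g: "g \<in> V"
    have "(\<lambda>g. if g \<in> V then r g else 0) = q"
    proof (rule q(2)[OF restrict[OF r(1)]])
      show "r g \<le> p g" if "g \<in> V" for g using r(2)[OF that] q1(2)[OF that] by simp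
      show "(\<lambda>g. if g \<in> V then r g else 0) \<le> q"
      proof (rule le_funI)
        fix g show "(if g \<in> V then r g else 0) \<le> q g"
          using r(2)[of g] q(1) by (cases "g \<in> V") (simp_all add: A_def)
      qed
    qed
    from fun_cong[OF this, of g] show "r g = q g" using g by simp
  qed
qed

text \<open>The functional \<open>g \<mapsto> inf\<^sub>t q(g + t h) - t q(h)\<close> is sublinear and below \<open>q\<close>, hence equal to \<open>q\<close>.\<close>

lemma minimal_sublinear_additive:
  assumes V: "lin_closed V" and q: "sublinear_on V q"
    and min: "\<And>r g. sublinear_on V r \<Longrightarrow> (\<And>h. h \<in> V \<Longrightarrow> r h \<le> q h) \<Longrightarrow> g \<in> V \<Longrightarrow> r g = q g"
    and g: "g \<in> V" and h: "h \<in> V"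
  shows "q (\<lambda>x. g x + h x) = q g + q h"
proof (rule antisym[OF sublinear_on_add[OF q g h]])
  define r where "r g = (INF t\<in>{0..}. q (\<lambda>x. g x + t * h x) - t * q h)" for g
  have cl: "(\<lambda>x. g x + t * h x) \<in> V" if "g \<in> V" for g t
    by (intro lin_closed_add[OF V] lin_closed_cmult[OF V] that h)
  have bdd: "bdd_below ((\<lambda>t. q (\<lambda>x. g x + t * h x) - t * q h) ` {0..})" if "g \<in> V" for g
  proof (rule bdd_belowI2)
    fix t :: real assume t: "t \<in> {0..}"
    have "q (\<lambda>x. (g x + t * h x) + (- g x)) \<le> q (\<lambda>x. g x + t * h x) + q (\<lambda>x. - g x)"
      by (rule sublinear_on_add[OF q cl[OF that] lin_closed_uminus[OF V that]])
    then show "- q (\<lambda>x. - g x) \<le> q (\<lambda>x. g x + t * h x) - t * q h"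
      using sublinear_on_cmult[OF q h, of t] t by simp
  qed
  have low: "r g \<le> q (\<lambda>x. g x + t * h x) - t * q h" if "g \<in> V" "t \<ge> 0" for g t
    unfolding r_def by (rule cINF_lower[OF bdd[OF that(1)]]) (use that in auto)
  have "sublinear_on V r"
    unfolding r_def
  proof (rule sublinear_on_INF[OF V _ bdd])
    fix g k and s t :: real assume *: "g \<in> V" "k \<in> V" "s \<in> {0..}" "t \<in> {0..}"
    have "q (\<lambda>x. (g x + s * h x) + (k x + t * h x)) \<le> q (\<lambda>x. g x + s * h x) + q (\<lambda>x. k x + t * h x)"
      by (intro sublinear_on_add[OF q] cl *)
    then have "q (\<lambda>x. g x + k x + (s + t) * h x) - (s + t) * q h
      \<le> q (\<lambda>x. g x + s * h x) - s * q h + (q (\<lambda>x. k x + t * h x) - t * q h)"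
      by (simp add: algebra_simps)
    then show "\<exists>r\<in>{0..}. q (\<lambda>x. g x + k x + r * h x) - r * q h
      \<le> q (\<lambda>x. g x + s * h x) - s * q h + (q (\<lambda>x. k x + t * h x) - t * q h)"
      using * by (intro bexI[of _ "s + t"]) auto
  next
    fix g and c t :: real assume *: "g \<in> V" "c > 0" "t \<in> {0..}"
    have "q (\<lambda>x. c * (g x + t * h x)) = c * q (\<lambda>x. g x + t * h x)"
      by (rule sublinear_on_cmult[OF q cl]) (use * in auto)
    then show "\<exists>r\<in>{0..}. q (\<lambda>x. c * g x + r * h x) - r * q h \<le> c * (q (\<lambda>x. g x + t * h x) - t * q h)"
      using * by (intro bexI[of _ "c * t"]) (auto simp: algebra_simps)
  next
    show "\<exists>r\<in>{0..}. q (\<lambda>x. 0 + r * h x) - r * q h \<le> 0"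
      using sublinear_on_cmult[OF q h, of 0] by (intro bexI[of _ 0]) auto
  qed auto
  moreover have "r k \<le> q k" if "k \<in> V" for k
    using low[OF that, of 0] by simp
  ultimately have "r g = q g" by (rule min[OF _ _ g])
  then show "q g + q h \<le> q (\<lambda>x. g x + h x)"
    using low[OF g, of 1] by simp
qed

text \<open>Nothing is extended from a subspace, so T need not be injective. The functional
  \<open>p'\<close>, the infimum over f of p(g - T f) + \<phi>(f), is sublinear. Taking f = 0 at a
  general g gives p' \<le> p; taking the same f at T f gives p'(T f) \<le> \<phi>(f). A minimal
  sublinear functional below \<open>p'\<close> is linear, and comparing f with -f turns the second
  inequality into an equality.\<close>

lemma Hahn_Banach_dominated:
  fixes T :: "'v::real_vector \<Rightarrow> 'c \<Rightarrow> real" and \<phi> :: "'v \<Rightarrow> real"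
  assumes V: "lin_closed V" and p: "sublinear_on V p"
    and T: "\<And>f. T f \<in> V" "\<And>f f'. T (f + f') = (\<lambda>x. T f x + T f' x)"
      "\<And>c f. T (c *\<^sub>R f) = (\<lambda>x. c * T f x)"
    and \<phi>: "linear \<phi>" and le: "\<And>f. \<phi> f \<le> p (T f)"
  obtains q where
    "\<And>g h. g \<in> V \<Longrightarrow> h \<in> V \<Longrightarrow> q (\<lambda>x. g x + h x) = q g + q h"
    "\<And>g c. g \<in> V \<Longrightarrow> q (\<lambda>x. c * g x) = c * q g"
    "\<And>g. g \<in> V \<Longrightarrow> q g \<le> p g"
    "\<And>f. q (T f) = \<phi> f"
proof -
  interpret \<phi>: linear \<phi> by fact
  have T0: "T 0 = (\<lambda>x. 0)" using T(3)[of 0 0] by simp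
  have Tm: "T (- f) = (\<lambda>x. - T f x)" for f using T(3)[of "-1" f] by simp
  define p' where "p' g = (INF f. p (\<lambda>x. g x - T f x) + \<phi> f)" for g
  have cl: "(\<lambda>x. g x - T f x) \<in> V" if "g \<in> V" for g f
    by (rule lin_closed_diff[OF V that T(1)])
  have bdd: "bdd_below (range (\<lambda>f. p (\<lambda>x. g x - T f x) + \<phi> f))" if "g \<in> V" for g
  proof (rule bdd_belowI2)
    fix f
    have "p (\<lambda>x. (g x - T f x) + (- g x)) \<le> p (\<lambda>x. g x - T f x) + p (\<lambda>x. - g x)"
      by (rule sublinear_on_add[OF p cl[OF that] lin_closed_uminus[OF V that]])
    moreover have "- \<phi> f \<le> p (\<lambda>x. - T f x)" using le[of "- f"] by (simp add: Tm \<phi>.neg)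
    ultimately show "- p (\<lambda>x. - g x) \<le> p (\<lambda>x. g x - T f x) + \<phi> f" by simp
  qed
  have low: "p' g \<le> p (\<lambda>x. g x - T f x) + \<phi> f" if "g \<in> V" for g f
    unfolding p'_def by (rule cINF_lower[OF bdd[OF that]]) simp
  have "sublinear_on V p'"
    unfolding p'_def
  proof (rule sublinear_on_INF[OF V _ bdd])
    fix g h s t assume *: "g \<in> V" "h \<in> V"
    have "p (\<lambda>x. (g x - T s x) + (h x - T t x)) \<le> p (\<lambda>x. g x - T s x) + p (\<lambda>x. h x - T t x)"
      by (intro sublinear_on_add[OF p] cl *)
    then show "\<exists>r\<in>UNIV. p (\<lambda>x. g x + h x - T r x) + \<phi> r
        \<le> p (\<lambda>x. g x - T s x) + \<phi> s + (p (\<lambda>x. h x - T t x) + \<phi> t)"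
      by (intro bexI[of _ "s + t"]) (auto simp: T \<phi>.add algebra_simps)
  next
    fix g t and c :: real assume *: "g \<in> V" "c > 0"
    have "p (\<lambda>x. c * (g x - T t x)) = c * p (\<lambda>x. g x - T t x)"
      by (rule sublinear_on_cmult[OF p cl]) (use * in auto)
    then show "\<exists>r\<in>UNIV. p (\<lambda>x. c * g x - T r x) + \<phi> r \<le> c * (p (\<lambda>x. g x - T t x) + \<phi> t)"
      by (intro bexI[of _ "c *\<^sub>R t"]) (auto simp: T \<phi>.scale algebra_simps)
  next
    show "\<exists>r\<in>UNIV. p (\<lambda>x. 0 - T r x) + \<phi> r \<le> 0"
      using sublinear_on_zero[OF V p] by (intro bexI[of _ 0]) (auto simp: T0 \<phi>.zero)
  qed auto
  then obtain q where q: "sublinear_on V q" "\<And>g. g \<in> V \<Longrightarrow> q g \<le> p' g"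
    "\<And>r g. sublinear_on V r \<Longrightarrow> (\<And>h. h \<in> V \<Longrightarrow> r h \<le> q h) \<Longrightarrow> g \<in> V \<Longrightarrow> r g = q g"
    by (rule minimal_sublinear_exists[OF V]) blast
  have add: "q (\<lambda>x. g x + h x) = q g + q h" if "g \<in> V" "h \<in> V" for g h
    by (rule minimal_sublinear_additive[OF V q(1) _ that]) (rule q(3))
  have neg: "q (\<lambda>x. - g x) = - q g" if "g \<in> V" for g
    using add[OF that lin_closed_uminus[OF V that]] sublinear_on_zero[OF V q(1)] by simp
  show thesis
  proof
    fix g and c :: real assume g: "g \<in> V"
    show "q (\<lambda>x. c * g x) = c * q g"
    proof (cases "c \<ge> 0")
      case False
      then have "q (\<lambda>x. - c * g x) = - c * q g" by (intro sublinear_on_cmult[OF q(1) g]) simp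
      then show ?thesis using neg[OF lin_closed_cmult[OF V g, of "- c"]] by simp
    qed (rule sublinear_on_cmult[OF q(1) g])
  next
    fix g assume g: "g \<in> V"
    show "q g \<le> p g"
      using q(2)[OF g] low[OF g, of 0] by (simp add: T0 \<phi>.zero)
  next
    fix f
    have "q (T f) \<le> \<phi> f" for f
      using q(2)[OF T(1), of f] low[of "T f" f] T(1)[of f] sublinear_on_zero[OF V p] by simp
    from this[of f] this[of "- f"] show "q (T f) = \<phi> f"
      using neg[OF T(1), of f] by (simp add: Tm \<phi>.neg)
  qed (fact add)
qed

section \<open>The Riesz--Markov theorem on compact Hausdorff spaces\<close>

text \<open>The laws concern total functions, but the value of \<psi> depends only on the
  restriction to \<open>topspace B\<close>, by \<open>mono\<close> in both directions.\<close>

locale positive_functional =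
  fixes B :: "'b topology" and \<psi> :: "('b \<Rightarrow> real) \<Rightarrow> real"
  assumes compact: "compact_space B" and Hausdorff: "Hausdorff_space B"
    and add: "continuous_map B euclideanreal g \<Longrightarrow> continuous_map B euclideanreal h \<Longrightarrow>
               \<psi> (\<lambda>x. g x + h x) = \<psi> g + \<psi> h"
    and cmult: "continuous_map B euclideanreal g \<Longrightarrow> \<psi> (\<lambda>x. c * g x) = c * \<psi> g"
    and nonneg: "continuous_map B euclideanreal g \<Longrightarrow> (\<And>x. x \<in> topspace B \<Longrightarrow> 0 \<le> g x) \<Longrightarrow> 0 \<le> \<psi> g"
begin

lemma normal: "normal_space B"
  by (simp add: compact Hausdorff compact_Hausdorff_or_regular_imp_normal_space)

lemma diff:
  assumes "continuous_map B euclideanreal g" "continuous_map B euclideanreal h"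
  shows "\<psi> (\<lambda>x. g x - h x) = \<psi> g - \<psi> h"
  using add[OF assms(1) continuous_map_minus[OF assms(2)]] cmult[OF assms(2), of "-1"] by simp

lemma mono:
  assumes "continuous_map B euclideanreal g" "continuous_map B euclideanreal h"
    and "\<And>x. x \<in> topspace B \<Longrightarrow> g x \<le> h x"
  shows "\<psi> g \<le> \<psi> h"
  using nonneg[of "\<lambda>x. h x - g x"] diff[OF assms(2,1)] assms
  by (simp add: continuous_map_diff)

lemma const: "\<psi> (\<lambda>x. c) = c * \<psi> (\<lambda>x. 1)"
  using cmult[of "\<lambda>x. 1" c] by simp

lemma zero: "\<psi> (\<lambda>x. 0) = 0"
  using const[of 0] by simp

lemma one_nonneg: "0 \<le> \<psi> (\<lambda>x. 1)"
  by (rule nonneg) auto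

lemma sum:
  assumes "finite I" "\<And>i. i \<in> I \<Longrightarrow> continuous_map B euclideanreal (g i)"
  shows "\<psi> (\<lambda>x. \<Sum>i\<in>I. g i x) = (\<Sum>i\<in>I. \<psi> (g i))"
  using assms
proof (induction I rule: finite_induct)
  case (insert i I)
  then have "continuous_map B euclideanreal (\<lambda>x. \<Sum>i\<in>I. g i x)"
    by (intro continuous_map_sum) auto
  with insert show ?case by (simp add: add)
qed (simp add: zero)

text \<open>Weaker than the usual subordination to U: g only vanishes off U, and its support may
  reach the boundary. \<open>content_add_le\<close> restores a closed subset of U.\<close>

definition below :: "'b set \<Rightarrow> ('b \<Rightarrow> real) set" where
  "below U = {g. continuous_map B euclideanreal g \<and>
     (\<forall>x\<in>topspace B. 0 \<le> g x \<and> g x \<le> 1 \<and> (x \<notin> U \<longrightarrow> g x = 0))}"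

definition open_content :: "'b set \<Rightarrow> ennreal" where
  "open_content U = (SUP g\<in>below U. ennreal (\<psi> g))"

definition outer_content :: "'b set \<Rightarrow> ennreal" where
  "outer_content E = (INF U\<in>{U. openin B U \<and> E \<subseteq> U}. open_content U)"

lemma zero_below: "(\<lambda>x. 0) \<in> below U"
  by (simp add: below_def)

lemma content_upper: "g \<in> below U \<Longrightarrow> ennreal (\<psi> g) \<le> open_content U"
  unfolding open_content_def by (rule SUP_upper)

lemma content_mono: "U \<subseteq> V \<Longrightarrow> open_content U \<le> open_content V"
  unfolding open_content_def by (rule SUP_subset_mono) (auto simp: below_def)

lemma content_le_total: "open_content U \<le> ennreal (\<psi> (\<lambda>x. 1))"
  unfolding open_content_def by (rule SUP_least) (auto simp: below_def intro!: ennreal_leI mono)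

text \<open>Replacing \<open>g\<close> by \<open>max 0 (g - \<epsilon>)\<close> shows that functions vanishing off a closed subset
  of \<open>U\<close> suffice.\<close>

lemma content_add_le:
  assumes *: "\<And>g C. g \<in> below U \<Longrightarrow> closedin B C \<Longrightarrow> C \<subseteq> U \<Longrightarrow> g \<in> below C \<Longrightarrow>
                ennreal (\<psi> g) + d \<le> c"
  shows "open_content U + d \<le> c"
proof -
  have ne: "below U \<noteq> {}" using zero_below by blast
  have "ennreal (\<psi> g) + d \<le> c" if g: "g \<in> below U" for g
  proof (rule ennreal_le_epsilon)
    fix e :: real assume "e > 0"
    \<comment> \<open>Truncating at \<epsilon> lowers \<psi> by at most \<epsilon> * \<psi>(1) \<le>
      e; the summand 1 in the denominator covers \<psi>(1) = 0.\<close>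
    define \<epsilon> where "\<epsilon> = min 1 (e / (\<psi> (\<lambda>x. 1) + 1))"
    have \<epsilon>: "0 < \<epsilon>" "\<epsilon> * \<psi> (\<lambda>x. 1) \<le> e"
    proof -
      show "0 < \<epsilon>" using \<open>e > 0\<close> one_nonneg by (simp add: \<epsilon>_def)
      have "\<epsilon> * \<psi> (\<lambda>x. 1) \<le> e / (\<psi> (\<lambda>x. 1) + 1) * \<psi> (\<lambda>x. 1)"
        using one_nonneg by (intro mult_right_mono) (simp_all add: \<epsilon>_def)
      also have "\<dots> \<le> e" using \<open>e > 0\<close> one_nonneg by (simp add: field_simps)
      finally show "\<epsilon> * \<psi> (\<lambda>x. 1) \<le> e" .
    qed
    have gc: "continuous_map B euclideanreal g" using g by (simp add: below_def)
    define k where "k x = max 0 (g x - \<epsilon>)" for x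
    have kc: "continuous_map B euclideanreal k"
      unfolding k_def by (intro continuous_map_real_max continuous_map_diff gc) auto
    define C where "C = {x \<in> topspace B. g x \<in> {\<epsilon>..}}"
    have C: "closedin B C"
      unfolding C_def by (rule closedin_continuous_map_preimage[OF gc]) simp
    have CU: "C \<subseteq> U"
      using g \<epsilon> by (force simp: C_def below_def)
    have k: "k \<in> below C"
      using g kc \<epsilon> by (force simp: below_def C_def k_def)
    then have "k \<in> below U" using CU by (auto simp: below_def)
    from *[OF this C CU k] have le: "ennreal (\<psi> k) + d \<le> c" .
    have "\<psi> g \<le> \<psi> (\<lambda>x. k x + \<epsilon>)"
      by (rule mono[OF gc continuous_map_add[OF kc]]) (auto simp: k_def)
    also have "\<dots> = \<psi> k + \<psi> (\<lambda>x. \<epsilon>)" by (rule add[OF kc]) simp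
    also have "\<dots> \<le> \<psi> k + e" using const[of \<epsilon>] \<epsilon> by simp
    finally have "ennreal (\<psi> g) \<le> ennreal (\<psi> k + e)" by (rule ennreal_leI)
    also have "\<dots> = ennreal (\<psi> k) + ennreal e"
      using \<open>e > 0\<close> nonneg[OF kc] by (intro ennreal_plus) (auto simp: k_def)
    finally have "ennreal (\<psi> g) + d \<le> (ennreal (\<psi> k) + d) + ennreal e"
      by (metis add.assoc add.commute add_right_mono)
    also have "\<dots> \<le> c + ennreal e" using le by (rule add_right_mono)
    finally show "ennreal (\<psi> g) + d \<le> c + ennreal e" .
  qed
  then show ?thesis
    unfolding open_content_def ennreal_SUP_add_left[OF ne, symmetric] by (rule SUP_least)
qed

lemma content_le:
  assumes "\<And>g C. g \<in> below U \<Longrightarrow> closedin B C \<Longrightarrow> C \<subseteq> U \<Longrightarrow> g \<in> below C \<Longrightarrow> ennreal (\<psi> g) \<le> c"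
  shows "open_content U \<le> c"
  using content_add_le[of U 0 c] assms by simp

lemma content_empty: "open_content {} = 0"
proof -
  have "\<psi> g = 0" if "g \<in> below {}" for g
  proof -
    have "\<psi> g \<le> \<psi> (\<lambda>x. 0)" by (rule mono) (use that in \<open>auto simp: below_def\<close>)
    moreover have "0 \<le> \<psi> g" by (rule nonneg) (use that in \<open>auto simp: below_def\<close>)
    ultimately show ?thesis using zero by simp
  qed
  then have "open_content {} \<le> 0" unfolding open_content_def by (intro SUP_least) simp
  then show ?thesis by simp
qed

lemma content_topspace: "open_content (topspace B) = ennreal (\<psi> (\<lambda>x. 1))"
  by (rule antisym[OF content_le_total content_upper]) (auto simp: below_def)

lemma below_nonneg: "g \<in> below U \<Longrightarrow> 0 \<le> \<psi> g"
  by (rule nonneg) (auto simp: below_def)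

text \<open>A Urysohn function u splits g into g * u, below U, and g * (1 - u), below V. It exists
  because g is carried by a closed C, so that C - V is closed and disjoint from the complement of
  U.\<close>

lemma content_Un:
  assumes U: "openin B U" and V: "openin B V"
  shows "open_content (U \<union> V) \<le> open_content U + open_content V"
proof (rule content_le)
  fix g C assume g: "g \<in> below (U \<union> V)" and C: "closedin B C" "C \<subseteq> U \<union> V" "g \<in> below C"
  have gc: "continuous_map B euclideanreal g" using g by (simp add: below_def)
  have "closedin B (C - V)" "closedin B (topspace B - U)"
    using C U V by auto
  moreover have "disjnt (topspace B - U) (C - V)" using C by (auto simp: disjnt_def)
  ultimately obtain u where u: "continuous_map B (top_of_set {0..1::real}) u"
    "u ` (topspace B - U) \<subseteq> {0}" "u ` (C - V) \<subseteq> {1}"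
    using Urysohn_lemma[OF normal, of "topspace B - U" "C - V" 0 1] by auto
  then have uc: "continuous_map B euclideanreal u" and u01: "\<And>x. x \<in> topspace B \<Longrightarrow> u x \<in> {0..1}"
    by (auto simp: continuous_map_in_subtopology)
  have 1: "(\<lambda>x. g x * u x) \<in> below U"
    unfolding below_def mem_Collect_eq
  proof (intro conjI ballI impI continuous_map_real_mult gc uc)
    fix x assume x: "x \<in> topspace B"
    show "0 \<le> g x * u x" "g x * u x \<le> 1"
      using x g u01[OF x] by (auto simp: below_def intro: mult_le_one)
    show "g x * u x = 0" if "x \<notin> U" using that u(2) x by auto
  qed
  have 2: "(\<lambda>x. g x * (1 - u x)) \<in> below V"
    unfolding below_def mem_Collect_eq
  proof (intro conjI ballI impI continuous_map_real_mult continuous_map_diff gc uc)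
    fix x assume x: "x \<in> topspace B"
    show "0 \<le> g x * (1 - u x)" "g x * (1 - u x) \<le> 1"
      using x g u01[OF x] by (auto simp: below_def intro: mult_le_one)
    show "g x * (1 - u x) = 0" if "x \<notin> V"
      using that u(3) x C(3) by (cases "x \<in> C") (auto simp: below_def)
  qed auto
  have "\<psi> g = \<psi> (\<lambda>x. g x * u x + g x * (1 - u x))" by (simp add: algebra_simps)
  also have "\<dots> = \<psi> (\<lambda>x. g x * u x) + \<psi> (\<lambda>x. g x * (1 - u x))"
    using 1 2 by (intro add) (auto simp: below_def)
  finally have "ennreal (\<psi> g) = ennreal (\<psi> (\<lambda>x. g x * u x)) + ennreal (\<psi> (\<lambda>x. g x * (1 - u x)))"
    using below_nonneg[OF 1] below_nonneg[OF 2] by simp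
  then show "ennreal (\<psi> g) \<le> open_content U + open_content V"
    using content_upper[OF 1] content_upper[OF 2] by (simp add: add_mono)
qed

lemma content_UN_finite:
  assumes "finite I" "\<And>i. i \<in> I \<Longrightarrow> openin B (U i)"
  shows "open_content (\<Union>i\<in>I. U i) \<le> (\<Sum>i\<in>I. open_content (U i))"
  using assms
proof (induction I rule: finite_induct)
  case (insert i I)
  have "open_content (U i \<union> (\<Union>i\<in>I. U i)) \<le> open_content (U i) + open_content (\<Union>i\<in>I. U i)"
    using insert.prems by (intro content_Un) auto
  also have "\<dots> \<le> open_content (U i) + (\<Sum>i\<in>I. open_content (U i))"
    using insert by (intro add_left_mono) auto
  finally show ?case using insert by simp
qed (simp add: content_empty)

text \<open>The closed set carrying g is compact, so finitely many of the sets already cover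
  it.\<close>

lemma content_UN:
  fixes U :: "nat \<Rightarrow> 'b set"
  assumes U: "\<And>i. openin B (U i)"
  shows "open_content (\<Union>i. U i) \<le> (\<Sum>i. open_content (U i))"
proof (rule content_le)
  fix g C assume C: "closedin B C" "C \<subseteq> (\<Union>i. U i)" "g \<in> below C"
  have "compactin B C" using closedin_compact_space[OF compact C(1)] .
  then obtain \<F> where \<F>: "finite \<F>" "\<F> \<subseteq> range U" "C \<subseteq> \<Union>\<F>"
    using compactinD[of B C "range U"] C(2) U by auto
  then obtain I where I: "finite I" "\<F> = U ` I"
    by (meson finite_subset_image)
  have "g \<in> below (\<Union>i\<in>I. U i)"
    using C(3) \<F>(3) I by (auto simp: below_def)
  then have "ennreal (\<psi> g) \<le> open_content (\<Union>i\<in>I. U i)" by (rule content_upper)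
  also have "\<dots> \<le> (\<Sum>i\<in>I. open_content (U i))" by (rule content_UN_finite[OF I(1) U])
  also have "\<dots> \<le> (\<Sum>i. open_content (U i))"
    using I(1) by (intro sum_le_suminf) auto
  finally show "ennreal (\<psi> g) \<le> (\<Sum>i. open_content (U i))" .
qed

section \<open>The outer measure and Caratheodory's construction\<close>

lemma outer_le: "openin B U \<Longrightarrow> E \<subseteq> U \<Longrightarrow> outer_content E \<le> open_content U"
  unfolding outer_content_def by (rule INF_lower) simp

lemma outer_open: "openin B U \<Longrightarrow> outer_content U = open_content U"
  by (rule antisym[OF outer_le]) (auto simp: outer_content_def intro!: INF_greatest content_mono)

lemma outer_mono: "E \<subseteq> F \<Longrightarrow> outer_content E \<le> outer_content F"
  unfolding outer_content_def by (rule INF_superset_mono) auto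

lemma countably_subadditive_outer: "countably_subadditive (Pow (topspace B)) outer_content"
  unfolding countably_subadditive_def
proof (intro allI impI)
  fix A :: "nat \<Rightarrow> 'b set"
  show "outer_content (\<Union>i. A i) \<le> (\<Sum>i. outer_content (A i))"
  proof (rule ennreal_le_epsilon)
    fix e :: real assume e: "0 < e" and fin: "(\<Sum>i. outer_content (A i)) < top"
    \<comment> \<open>Finiteness of the total makes each term finite, so adding a positive amount
      gives a strict inequality and hence a covering open set.\<close>
    then have "outer_content (A n) < outer_content (A n) + ennreal (e * (1/2)^Suc n)" for n
      by (auto simp add: less_top dest!: ennreal_suminf_lessD)
    then have "\<exists>U. openin B U \<and> A n \<subseteq> U \<and> open_content U < outer_content (A n) + ennreal (e * (1/2)^Suc n)" for n
      unfolding outer_content_def INF_less_iff by auto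
    then obtain U where U: "\<And>n. openin B (U n)" "\<And>n. A n \<subseteq> U n"
      "\<And>n. open_content (U n) < outer_content (A n) + ennreal (e * (1/2)^Suc n)"
      by metis
    have "outer_content (\<Union>i. A i) \<le> open_content (\<Union>i. U i)"
      using U by (intro outer_le) auto
    also have "\<dots> \<le> (\<Sum>i. open_content (U i))" by (rule content_UN[OF U(1)])
    also have "\<dots> \<le> (\<Sum>n. outer_content (A n) + ennreal (e * (1/2)^Suc n))"
      using U(3) by (intro suminf_le less_imp_le) auto
    also have "\<dots> = (\<Sum>n. outer_content (A n)) + (\<Sum>n. ennreal (e * (1/2)^Suc n))"
      by (subst suminf_add) auto
    also have "(\<Sum>n. ennreal (e * (1/2)^Suc n)) = ennreal e"
      by (rule suminf_ennreal_eq) (use e sums_mult[OF power_half_series, of e] in auto)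
    finally show "outer_content (\<Union>i. A i) \<le> (\<Sum>i. outer_content (A i)) + ennreal e" .
  qed
qed

lemma outer_measure_space_outer: "outer_measure_space (Pow (topspace B)) outer_content"
  unfolding outer_measure_space_def
  by (auto simp: positive_def increasing_def outer_mono countably_subadditive_outer
      outer_open[OF openin_empty] content_empty)

text \<open>The substantial half of the Caratheodory condition, for an open test set V. If g is
  carried by a closed C inside U \<inter> V, then V - C is open and contains V - U, and any h below
  V - C vanishes on C. Hence g + h is still at most 1 and lies below V. Both contents are suprema,
  so \<open>content_add_le\<close> is applied once for g and once for h.\<close>

lemma content_split:
  assumes U: "openin B U" and V: "openin B V"
  shows "open_content (U \<inter> V) + outer_content (V - U) \<le> open_content V"
proof (rule content_add_le)
  fix g C assume g: "g \<in> below (U \<inter> V)" and C: "closedin B C" "C \<subseteq> U \<inter> V" "g \<in> below C"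
  have "open_content (V - C) + ennreal (\<psi> g) \<le> open_content V"
  proof (rule content_add_le)
    fix h assume h: "h \<in> below (V - C)"
    have "(\<lambda>x. g x + h x) \<in> below V"
      unfolding below_def mem_Collect_eq
    proof (intro conjI ballI impI continuous_map_add)
      fix x assume x: "x \<in> topspace B"
      show "0 \<le> g x + h x" using x g h by (auto simp: below_def)
      show "g x + h x \<le> 1" using x C(3) h by (cases "x \<in> C") (auto simp: below_def)
      show "g x + h x = 0" if "x \<notin> V" using that x g h by (auto simp: below_def)
    qed (use g h in \<open>auto simp: below_def\<close>)
    then have "ennreal (\<psi> (\<lambda>x. g x + h x)) \<le> open_content V" by (rule content_upper)
    moreover have "\<psi> (\<lambda>x. g x + h x) = \<psi> g + \<psi> h"
      using g h by (intro add) (auto simp: below_def)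
    ultimately show "ennreal (\<psi> h) + ennreal (\<psi> g) \<le> open_content V"
      using below_nonneg[OF g] below_nonneg[OF h] by (simp add: add.commute)
  qed
  moreover have "outer_content (V - U) \<le> open_content (V - C)"
    using V C by (intro outer_le) auto
  ultimately show "ennreal (\<psi> g) + outer_content (V - U) \<le> open_content V"
    by (metis add.commute add_left_mono order_trans)
qed

text \<open>One inequality is subadditivity. The other passes from open V to arbitrary E because the
  outer content of E is an infimum over open supersets.\<close>

lemma open_in_lambda_system:
  assumes U: "openin B U"
  shows "U \<in> lambda_system (topspace B) (Pow (topspace B)) outer_content"
  unfolding lambda_system_def
proof (intro CollectI conjI ballI)
  show "U \<in> Pow (topspace B)" using openin_subset[OF U] by simp
  fix E assume E: "E \<in> Pow (topspace B)"
  have sub: "E = (U \<inter> E) \<union> ((topspace B - U) \<inter> E)" using E by auto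
  have "subadditive (Pow (topspace B)) outer_content"
    by (rule ring_of_sets.countably_subadditive_subadditive[where \<Omega> = "topspace B"])
      (use outer_measure_space_outer in
        \<open>auto simp: outer_measure_space_def intro!: algebra.axioms(1) algebra_Pow\<close>)
  then have "outer_content ((U \<inter> E) \<union> ((topspace B - U) \<inter> E)) \<le> outer_content (U \<inter> E) + outer_content ((topspace B - U) \<inter> E)"
    by (rule subadditiveD) (use E in auto)
  moreover have "outer_content (U \<inter> E) + outer_content ((topspace B - U) \<inter> E) \<le> outer_content E"
    unfolding outer_content_def[of E]
  proof (rule INF_greatest, clarify)
    fix V assume V: "openin B V" "E \<subseteq> V"
    have "outer_content (U \<inter> E) + outer_content ((topspace B - U) \<inter> E) \<le> open_content (U \<inter> V) + outer_content (V - U)"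
      using V U by (intro add_mono outer_le outer_mono) auto
    also have "\<dots> \<le> open_content V" by (rule content_split[OF U V(1)])
    finally show "outer_content (U \<inter> E) + outer_content ((topspace B - U) \<inter> E) \<le> open_content V" .
  qed
  ultimately show "outer_content (U \<inter> E) + outer_content ((topspace B - U) \<inter> E) = outer_content E"
    using sub by (metis order_antisym)
qed

definition riesz_measure :: "'b measure" where
  "riesz_measure = measure_of (topspace B) {U. openin B U} outer_content"

lemma openin_Pow: "{U. openin B U} \<subseteq> Pow (topspace B)"
  using openin_subset by auto

lemma space_riesz: "space riesz_measure = topspace B"
  and sets_riesz: "sets riesz_measure = sigma_sets (topspace B) {U. openin B U}"
  unfolding riesz_measure_def using openin_Pow by (simp_all add: space_measure_of sets_measure_of)

lemma sets_riesz_borel_of: "sets riesz_measure = sets (borel_of B)"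
  unfolding sets_riesz borel_of_def using openin_Pow by (simp add: sets_measure_of)

lemma emeasure_riesz:
  assumes "E \<in> sets riesz_measure"
  shows "emeasure riesz_measure E = outer_content E"
proof -
  let ?L = "lambda_system (topspace B) (Pow (topspace B)) outer_content"
  have L: "measure_space (topspace B) ?L outer_content"
    by (rule sigma_algebra.caratheodory_lemma[OF sigma_algebra_Pow outer_measure_space_outer])
  have "sigma_sets (topspace B) {U. openin B U} \<subseteq> ?L"
    using L open_in_lambda_system
    by (intro sigma_algebra.sigma_sets_subset) (auto simp: measure_space_def)
  then have "measure_space (topspace B) (sigma_sets (topspace B) {U. openin B U}) outer_content"
    by (rule measure_down[OF L sigma_algebra_sigma_sets[OF openin_Pow]])
  then show ?thesis
    using assms unfolding riesz_measure_def
    by (intro emeasure_measure_of[OF refl openin_Pow])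
      (auto simp: measure_space_def sets_riesz riesz_measure_def[symmetric])
qed

lemma open_sets_riesz: "openin B U \<Longrightarrow> U \<in> sets riesz_measure"
  by (simp add: sets_riesz sigma_sets.Basic)

lemma emeasure_riesz_open: "openin B U \<Longrightarrow> emeasure riesz_measure U = open_content U"
  by (simp add: emeasure_riesz open_sets_riesz outer_open)

lemma emeasure_riesz_space: "emeasure riesz_measure (space riesz_measure) = ennreal (\<psi> (\<lambda>x. 1))"
  by (simp add: space_riesz emeasure_riesz_open content_topspace)

lemma finite_riesz: "finite_measure riesz_measure"
  by (rule finite_measureI) (simp add: emeasure_riesz_space)

lemma closed_sets_riesz:
  assumes "closedin B C"
  shows "C \<in> sets riesz_measure"
proof -
  have "space riesz_measure - (topspace B - C) \<in> sets riesz_measure"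
    using assms by (intro sets.compl_sets open_sets_riesz) auto
  moreover have "space riesz_measure - (topspace B - C) = C"
    using closedin_subset[OF assms] by (auto simp: space_riesz)
  ultimately show ?thesis by simp
qed

text \<open>Outer regularity is built into \<open>outer_content\<close>. Applied to the complement
  of E it gives an open U, whose complement is closed, hence compact, and lies in E.\<close>

lemma inner_regular_riesz:
  assumes E: "E \<in> sets riesz_measure"
  shows "emeasure riesz_measure E = (SUP K\<in>{K. compactin B K \<and> K \<subseteq> E}. emeasure riesz_measure K)"
proof (rule antisym)
  interpret finite_measure riesz_measure by (rule finite_riesz)
  let ?X = "topspace B" and ?\<mu> = "emeasure riesz_measure"
  let ?S = "SUP K\<in>{K. compactin B K \<and> K \<subseteq> E}. ?\<mu> K"
  have EX: "E \<subseteq> ?X" using sets.sets_into_space[OF E] by (simp add: space_riesz)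
  show "?S \<le> ?\<mu> E" using E by (intro SUP_least emeasure_mono) auto
  show "?\<mu> E \<le> ?S"
  proof (rule ennreal_le_epsilon)
    fix e :: real assume e: "0 < e"
    have E': "?X - E \<in> sets riesz_measure" using E by (metis sets.compl_sets space_riesz)
    have "outer_content (?X - E) < outer_content (?X - E) + ennreal e"
      using e emeasure_finite[of "?X - E"] emeasure_riesz[OF E'] by (auto simp: less_top)
    then obtain U where U: "openin B U" "?X - E \<subseteq> U" "open_content U < outer_content (?X - E) + ennreal e"
      unfolding outer_content_def INF_less_iff by auto
    define K where "K = ?X - U"
    have K: "closedin B K" "K \<subseteq> E" using U by (auto simp: K_def)
    then have "compactin B K" using closedin_compact_space[OF compact] by blast
    then have "?\<mu> K \<le> ?S" using K by (intro SUP_upper) auto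
    have Um: "U \<in> sets riesz_measure" by (rule open_sets_riesz[OF U(1)])
    have "?\<mu> (U - (?X - E)) + ?\<mu> (?X - E) = ?\<mu> U"
      using Um E' U(2) by (subst plus_emeasure) (auto simp: Un_absorb2)
    also have "\<dots> \<le> ennreal e + ?\<mu> (?X - E)"
      using U(3) by (simp add: emeasure_riesz_open[OF U(1)] emeasure_riesz[OF E'] add.commute less_imp_le)
    finally have small: "?\<mu> (U - (?X - E)) \<le> ennreal e"
      using emeasure_finite[of "?X - E"] by (simp add: ennreal_add_left_cancel_le add.commute)
    have "E \<subseteq> K \<union> (U - (?X - E))" using EX by (auto simp: K_def)
    then have "?\<mu> E \<le> ?\<mu> (K \<union> (U - (?X - E)))"
      using K closed_sets_riesz Um E' by (intro emeasure_mono) auto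
    also have "\<dots> \<le> ?\<mu> K + ?\<mu> (U - (?X - E))"
      using K closed_sets_riesz Um E' by (intro emeasure_subadditive) auto
    also have "\<dots> \<le> ?S + ennreal e"
      using small \<open>?\<mu> K \<le> ?S\<close> by (rule add_mono[rotated])
    finally show "?\<mu> E \<le> ?S + ennreal e" .
  qed
qed

lemma riesz_radon: "riesz_measure \<in> pos_radon_measures B"
  using finite_riesz inner_regular_riesz by (auto simp: pos_radon_measures_def sets_riesz_borel_of)

section \<open>Integration against the Riesz measure\<close>

lemma measurable_riesz:
  assumes g: "continuous_map B euclideanreal g"
  shows "g \<in> borel_measurable riesz_measure"
proof (rule borel_measurableI)
  fix S :: "real set" assume "open S"
  then have "openin B {x \<in> topspace B. g x \<in> S}"
    using openin_continuous_map_preimage[OF g] by simp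
  moreover have "g -` S \<inter> space riesz_measure = {x \<in> topspace B. g x \<in> S}"
    by (auto simp: space_riesz)
  ultimately show "g -` S \<inter> space riesz_measure \<in> sets riesz_measure"
    by (simp add: open_sets_riesz)
qed

lemma continuous_bounded:
  assumes g: "continuous_map B euclideanreal g"
  obtains c where "c > 0" "\<And>x. x \<in> topspace B \<Longrightarrow> \<bar>g x\<bar> \<le> c"
proof -
  have "compactin euclidean (g ` topspace B)"
    using image_compactin[OF _ g] compact by (simp add: compact_space_def)
  then have "bounded (g ` topspace B)" by (simp add: compact_imp_bounded)
  then show thesis using that by (auto simp: bounded_pos)
qed

lemma integrable_riesz:
  assumes g: "continuous_map B euclideanreal g"
  shows "integrable riesz_measure g"
proof -
  obtain c where "\<And>x. x \<in> topspace B \<Longrightarrow> \<bar>g x\<bar> \<le> c" using continuous_bounded[OF g] by blast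
  then show ?thesis
    using measurable_riesz[OF g]
    by (intro finite_measure.integrable_const_bound[OF finite_riesz, of _ c])
      (auto intro!: AE_I2 simp: space_riesz)
qed

lemma measure_riesz_space: "measure riesz_measure (topspace B) = \<psi> (\<lambda>x. 1)"
  using emeasure_riesz_space one_nonneg by (simp add: measure_def space_riesz)

lemma sum_clamp:
  fixes t :: real
  assumes "0 \<le> t"
  shows "(\<Sum>k<n. max 0 (min 1 (t - real k))) = min t (real n)"
  using assms by (induction n) auto

text \<open>Layer-cake: \<open>n * g\<close> is the sum of the clamped functions \<open>max 0 (min 1 (n * g - k))\<close>.\<close>

lemma le_integral_riesz:
  assumes g: "continuous_map B euclideanreal g"
    and g01: "\<And>x. x \<in> topspace B \<Longrightarrow> 0 \<le> g x \<and> g x \<le> 1"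
  shows "\<psi> g \<le> (\<integral>x. g x \<partial>riesz_measure)"
proof -
  interpret finite_measure riesz_measure by (rule finite_riesz)
  \<comment> \<open>The error term \<psi>(1) does not grow with n, so the Archimedean property
    removes it at the end.\<close>
  have bound: "real n * \<psi> g \<le> real n * (\<integral>x. g x \<partial>riesz_measure) + \<psi> (\<lambda>x. 1)" for n
  proof -
    define G where "G k x = max 0 (min 1 (real n * g x - real k))" for k x
    define U where "U k = {x \<in> topspace B. g x * real n \<in> {real k<..}}" for k
    have ng: "continuous_map B euclideanreal (\<lambda>x. g x * real n)"
      by (intro continuous_map_real_mult_right g)
    have Gc: "continuous_map B euclideanreal (G k)" for k
      unfolding G_def using ng
      by (intro continuous_map_real_max continuous_map_real_min continuous_map_diff)
        (auto simp: mult.commute)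
    have U: "openin B (U k)" for k
      unfolding U_def by (rule openin_continuous_map_preimage[OF ng]) simp
    have GU: "G k \<in> below (U k)" for k
      using Gc by (auto simp: below_def U_def G_def mult.commute)
    have ind: "integrable riesz_measure (indicat_real (U k))" for k
      using open_sets_riesz[OF U] by (intro integrable_real_indicator) (auto simp: less_top[symmetric])
    have psiG: "\<psi> (G k) \<le> measure riesz_measure (U k)" for k
    proof -
      have "ennreal (\<psi> (G k)) \<le> ennreal (measure riesz_measure (U k))"
        using content_upper[OF GU] emeasure_riesz_open[OF U] by (simp add: emeasure_eq_measure)
      then show ?thesis by simp
    qed
    have "real n * \<psi> g = \<psi> (\<lambda>x. real n * g x)" by (simp add: cmult[OF g])
    also have "\<dots> \<le> \<psi> (\<lambda>x. \<Sum>k<n. G k x)"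
    proof (rule mono)
      show "real n * g x \<le> (\<Sum>k<n. G k x)" if "x \<in> topspace B" for x
      proof -
        have "real n * g x \<le> real n * 1" using g01[OF that] by (intro mult_left_mono) auto
        then show ?thesis using g01[OF that] by (simp add: G_def sum_clamp)
      qed
    qed (intro continuous_map_real_mult_left g continuous_map_sum Gc; simp)+
    also have "\<dots> = (\<Sum>k<n. \<psi> (G k))" by (rule sum) (auto intro: Gc)
    also have "\<dots> \<le> (\<Sum>k<n. measure riesz_measure (U k))" by (intro sum_mono psiG)
    also have "\<dots> = (\<Sum>k<n. \<integral>x. indicator (U k) x \<partial>riesz_measure)"
      using open_sets_riesz[OF U] sets.sets_into_space by (simp add: Int_absorb2)
    also have "\<dots> = (\<integral>x. (\<Sum>k<n. indicator (U k) x) \<partial>riesz_measure)"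
      by (intro Bochner_Integration.integral_sum[symmetric] ind)
    also have "\<dots> \<le> (\<integral>x. real n * g x + 1 \<partial>riesz_measure)"
    proof (rule integral_mono)
      fix x assume x: "x \<in> space riesz_measure"
      \<comment> \<open>On \<open>U k\<close> the number n * g(x) exceeds k, so after a shift by one
        the k-th clamp equals 1. The shift is the origin of the extra +1.\<close>
      have "(\<Sum>k<n. indicator (U k) x) \<le> (\<Sum>k<n. max 0 (min 1 (real n * g x + 1 - real k)))"
        by (intro sum_mono) (auto simp: U_def indicator_def mult.commute)
      also have "\<dots> \<le> real n * g x + 1"
        using g01[of x] x by (subst sum_clamp) (auto simp: space_riesz)
      finally show "(\<Sum>k<n. indicator (U k) x) \<le> real n * g x + 1" .
    qed (use ind integrable_riesz[OF g] in auto)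
    also have "\<dots> = real n * (\<integral>x. g x \<partial>riesz_measure) + \<psi> (\<lambda>x. 1)"
      using integrable_riesz[OF g] measure_riesz_space by (simp add: space_riesz)
    finally show ?thesis .
  qed
  show ?thesis
  proof (rule ccontr)
    assume "\<not> ?thesis"
    then obtain n where "\<psi> (\<lambda>x. 1) < real n * (\<psi> g - (\<integral>x. g x \<partial>riesz_measure))"
      using reals_Archimedean3[of "\<psi> g - (\<integral>x. g x \<partial>riesz_measure)"] by auto
    with bound[of n] show False by (simp add: algebra_simps)
  qed
qed

lemma integral_riesz:
  assumes g: "continuous_map B euclideanreal g"
  shows "(\<integral>x. g x \<partial>riesz_measure) = \<psi> g"
proof -
  interpret finite_measure riesz_measure by (rule finite_riesz)
  have *: "(\<integral>x. k x \<partial>riesz_measure) = \<psi> k"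
    if k: "continuous_map B euclideanreal k" and k01: "\<And>x. x \<in> topspace B \<Longrightarrow> 0 \<le> k x \<and> k x \<le> 1" for k
  proof (rule antisym[OF _ le_integral_riesz[OF that]])
    \<comment> \<open>The opposite inequality is the known one for 1 - k, since the integral and
      \<psi> agree on constants.\<close>
    have "\<psi> (\<lambda>x. 1 - k x) \<le> (\<integral>x. 1 - k x \<partial>riesz_measure)"
      by (rule le_integral_riesz) (use k k01 in \<open>auto intro!: continuous_map_diff\<close>)
    also have "\<dots> = \<psi> (\<lambda>x. 1) - (\<integral>x. k x \<partial>riesz_measure)"
      using integrable_riesz[OF k] measure_riesz_space by (simp add: space_riesz)
    finally show "(\<integral>x. k x \<partial>riesz_measure) \<le> \<psi> k"
      using diff[of "\<lambda>x. 1" k] k by simp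
  qed
  obtain c where c: "c > 0" "\<And>x. x \<in> topspace B \<Longrightarrow> \<bar>g x\<bar> \<le> c" using continuous_bounded[OF g] by blast
  \<comment> \<open>The affine map from [-c, c] onto [0, 1] brings g into the range treated
    above.\<close>
  define k where "k x = (1 / (2 * c)) * (g x + c)" for x
  have gc: "continuous_map B euclideanreal (\<lambda>x. g x + c)" by (intro continuous_map_add g) simp
  then have k: "continuous_map B euclideanreal k"
    unfolding k_def by (rule continuous_map_real_mult_left)
  have "0 \<le> k x \<and> k x \<le> 1" if "x \<in> topspace B" for x
    using c(1) c(2)[OF that] by (auto simp: k_def field_simps abs_le_iff)
  from *[OF k this] have "(\<integral>x. k x \<partial>riesz_measure) = \<psi> k" .
  moreover have "(\<integral>x. k x \<partial>riesz_measure) = (1 / (2 * c)) * ((\<integral>x. g x \<partial>riesz_measure) + c * \<psi> (\<lambda>x. 1))"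
    unfolding k_def using integrable_riesz[OF g] measure_riesz_space by (simp add: space_riesz mult.commute)
  moreover have "\<psi> k = (1 / (2 * c)) * (\<psi> g + c * \<psi> (\<lambda>x. 1))"
    unfolding k_def cmult[OF gc] using add[OF g, of "\<lambda>x. c"] const[of c] by simp
  ultimately show ?thesis using c(1) by simp
qed

end

section \<open>Representing measures carried by a closed set\<close>

definition sup_pos :: "'b set \<Rightarrow> ('b \<Rightarrow> real) \<Rightarrow> real" where
  "sup_pos E g = Sup (insert 0 (g ` E))"

lemma sup_pos_nonneg:
  assumes "bdd_above (g ` E)"
  shows "0 \<le> sup_pos E g"
  unfolding sup_pos_def using assms by (intro cSup_upper) auto

lemma sup_pos_upper:
  assumes "bdd_above (g ` E)" "x \<in> E"
  shows "g x \<le> sup_pos E g"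
  unfolding sup_pos_def using assms by (intro cSup_upper) auto

lemma sup_pos_least:
  assumes "0 \<le> s" "\<And>x. x \<in> E \<Longrightarrow> g x \<le> s"
  shows "sup_pos E g \<le> s"
  unfolding sup_pos_def using assms by (intro cSup_least) auto

lemma sublinear_on_sup_pos:
  assumes bdd: "\<And>g. g \<in> V \<Longrightarrow> bdd_above (g ` E)" and "0 \<le> c"
  shows "sublinear_on V (\<lambda>g. c * sup_pos E g)"
  unfolding sublinear_on_def
proof (intro conjI ballI allI impI)
  fix g h assume "g \<in> V" "h \<in> V"
  then have "sup_pos E (\<lambda>x. g x + h x) \<le> sup_pos E g + sup_pos E h"
    by (intro sup_pos_least add_mono add_nonneg_nonneg sup_pos_upper sup_pos_nonneg bdd)
  then show "c * sup_pos E (\<lambda>x. g x + h x) \<le> c * sup_pos E g + c * sup_pos E h"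
    using \<open>0 \<le> c\<close> by (simp add: mult_left_mono flip: distrib_left)
next
  fix g and a :: real assume g: "g \<in> V" and a: "0 \<le> a"
  have le: "sup_pos E (\<lambda>x. a * g x) \<le> a * sup_pos E g"
    using g a by (intro sup_pos_least mult_left_mono mult_nonneg_nonneg sup_pos_upper sup_pos_nonneg bdd)
  have bdd': "bdd_above ((\<lambda>x. a * g x) ` E)"
    using sup_pos_upper[OF bdd[OF g]] a by (intro bdd_aboveI2[of _ _ "a * sup_pos E g"] mult_left_mono) auto
  have "a * sup_pos E g \<le> sup_pos E (\<lambda>x. a * g x)"
  proof (cases "a = 0")
    case False
    with a have "a > 0" by simp
    have "sup_pos E g \<le> sup_pos E (\<lambda>x. a * g x) / a"
    proof (rule sup_pos_least)
      show "0 \<le> sup_pos E (\<lambda>x. a * g x) / a"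
        using \<open>a > 0\<close> sup_pos_nonneg[OF bdd'] by simp
      show "g x \<le> sup_pos E (\<lambda>x. a * g x) / a" if "x \<in> E" for x
        using \<open>a > 0\<close> sup_pos_upper[OF bdd' that] by (simp add: field_simps)
    qed
    then show ?thesis using \<open>a > 0\<close> by (simp add: field_simps)
  qed (use sup_pos_nonneg[OF bdd'] in simp)
  with le show "c * sup_pos E (\<lambda>x. a * g x) = a * (c * sup_pos E g)" by simp
qed

lemma radon_representation_on_closed:
  fixes T :: "'v::real_vector \<Rightarrow> 'b \<Rightarrow> real" and \<phi> :: "'v \<Rightarrow> real"
  assumes B: "compact_space B" "Hausdorff_space B" and E: "closedin B E" and c: "0 \<le> c"
    and T: "\<And>f. continuous_map B euclideanreal (T f)" "\<And>f f'. T (f + f') = (\<lambda>x. T f x + T f' x)"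
      "\<And>c f. T (c *\<^sub>R f) = (\<lambda>x. c * T f x)"
    and \<phi>: "linear \<phi>"
    and le: "\<And>f s. 0 \<le> s \<Longrightarrow> (\<And>x. x \<in> E \<Longrightarrow> T f x \<le> s) \<Longrightarrow> \<phi> f \<le> c * s"
  obtains \<mu> where "\<mu> \<in> pos_radon_measures B" "measure \<mu> (topspace B) \<le> c"
    "\<And>f. (\<integral>x. T f x \<partial>\<mu>) = \<phi> f" "msupp B \<mu> \<subseteq> E"
proof -
  define V where "V = {g. continuous_map B euclideanreal g}"
  have "(\<lambda>x. 0) \<in> V" by (simp add: V_def)
  then have "V \<noteq> {}" by blast
  then have V: "lin_closed V"
    unfolding lin_closed_def by (simp add: V_def continuous_map_add continuous_map_real_mult_left)
  have bdd: "bdd_above (g ` E)" if "g \<in> V" for g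
  proof -
    have "compactin euclidean (g ` E)"
      using image_compactin[OF closedin_compact_space[OF B(1) E], of euclideanreal g] that
      by (simp add: V_def)
    then show ?thesis by (simp add: compact_imp_bounded bounded_imp_bdd_above)
  qed
  have p: "sublinear_on V (\<lambda>g. c * sup_pos E g)"
    by (rule sublinear_on_sup_pos[OF bdd c])
  have "\<phi> f \<le> c * sup_pos E (T f)" for f
    using T(1) by (intro le sup_pos_nonneg sup_pos_upper bdd) (auto simp: V_def)
  then obtain q where q: "\<And>g h. g \<in> V \<Longrightarrow> h \<in> V \<Longrightarrow> q (\<lambda>x. g x + h x) = q g + q h"
    "\<And>g c. g \<in> V \<Longrightarrow> q (\<lambda>x. c * g x) = c * q g"
    "\<And>g. g \<in> V \<Longrightarrow> q g \<le> c * sup_pos E g" "\<And>f. q (T f) = \<phi> f"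
    using Hahn_Banach_dominated[OF V p, of T \<phi>] T \<phi> by (auto simp: V_def)
  \<comment> \<open>This yields two of the conclusions: applied to -g it gives positivity, and
    applied to functions below the complement of E, which vanish on E, it makes that complement
    null. The mass bound is the domination at the constant 1.\<close>
  have q_le: "q g \<le> 0" if "g \<in> V" "\<And>x. x \<in> E \<Longrightarrow> g x \<le> 0" for g
  proof -
    have "c * sup_pos E g \<le> c * 0"
      using c that(2) by (intro mult_left_mono sup_pos_least) auto
    then show ?thesis using q(3)[OF that(1)] by simp
  qed
  interpret positive_functional B q
  proof
    fix g assume g: "continuous_map B euclideanreal g" "\<And>x. x \<in> topspace B \<Longrightarrow> 0 \<le> g x"
    have "q (\<lambda>x. - 1 * g x) \<le> 0"
      using g(2) closedin_subset[OF E] by (intro q_le lin_closed_cmult[OF V]) (auto simp: V_def g(1))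
    then show "0 \<le> q g" using q(2)[of g "-1"] g(1) by (simp add: V_def)
  qed (use B q in \<open>auto simp: V_def\<close>)
  show thesis
  proof
    show "riesz_measure \<in> pos_radon_measures B" by (rule riesz_radon)
    have "q (\<lambda>x. 1) \<le> c * sup_pos E (\<lambda>x. 1)" by (intro q) (simp add: V_def)
    also have "\<dots> \<le> c * 1" using c by (intro mult_left_mono sup_pos_least) auto
    finally show "measure riesz_measure (topspace B) \<le> c" by (simp add: measure_riesz_space)
    show "(\<integral>x. T f x \<partial>riesz_measure) = \<phi> f" for f
      using integral_riesz[OF T(1)] q(4) by simp
    have U: "openin B (topspace B - E)" using E by auto
    have "open_content (topspace B - E) \<le> 0"
      unfolding open_content_def
    proof (rule SUP_least)
      fix g assume g: "g \<in> below (topspace B - E)"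
      have "q g \<le> 0"
        using g closedin_subset[OF E] by (intro q_le) (auto simp: below_def V_def)
      then show "ennreal (q g) \<le> 0" by (simp add: ennreal_neg)
    qed
    then have "emeasure riesz_measure (topspace B - E) = 0"
      using emeasure_riesz_open[OF U] by simp
    then show "msupp B riesz_measure \<subseteq> E"
      using U by (auto simp: msupp_def)
  qed
qed

section \<open>Supports of Radon measures\<close>

lemma pos_radon_measuresD:
  assumes "\<mu> \<in> pos_radon_measures B"
  shows "space \<mu> = topspace B" "finite_measure \<mu>" "openin B U \<Longrightarrow> U \<in> sets \<mu>"
    "E \<in> sets \<mu> \<Longrightarrow> emeasure \<mu> E = (SUP K\<in>{K. compactin B K \<and> K \<subseteq> E}. emeasure \<mu> K)"
proof -
  have sets: "sets \<mu> = sets (borel_of B)"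
    using assms by (simp add: pos_radon_measures_def)
  have sub: "{U. openin B U} \<subseteq> Pow (topspace B)" using openin_subset by auto
  show "space \<mu> = topspace B"
    using sets_eq_imp_space_eq[OF sets] sub by (simp add: borel_of_def space_measure_of)
  show "openin B U \<Longrightarrow> U \<in> sets \<mu>"
    unfolding sets borel_of_def using sub by (simp add: sets_measure_of)
  show "finite_measure \<mu>" using assms by (simp add: pos_radon_measures_def)
  show "E \<in> sets \<mu> \<Longrightarrow> emeasure \<mu> E = (SUP K\<in>{K. compactin B K \<and> K \<subseteq> E}. emeasure \<mu> K)"
    using assms unfolding pos_radon_measures_def by blast
qed

lemma closedin_msupp: "closedin B (msupp B \<mu>)"
  unfolding closedin_def
proof
  show "msupp B \<mu> \<subseteq> topspace B" by (auto simp: msupp_def)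
  show "openin B (topspace B - msupp B \<mu>)"
  proof (subst openin_subopen, rule ballI)
    fix x assume x: "x \<in> topspace B - msupp B \<mu>"
    then obtain U where U: "openin B U" "x \<in> U" "\<not> emeasure \<mu> U > 0"
      by (auto simp: msupp_def)
    then have "U \<subseteq> topspace B - msupp B \<mu>"
      using openin_subset[OF U(1)] by (auto simp: msupp_def)
    with U show "\<exists>T. openin B T \<and> x \<in> T \<and> T \<subseteq> topspace B - msupp B \<mu>" by blast
  qed
qed

text \<open>The complement of the support is a possibly uncountable union of null open sets. Inner
  regularity reduces its measure to compact subsets, each covered by finitely many of them.\<close>

lemma emeasure_outside_msupp:
  assumes \<mu>: "\<mu> \<in> pos_radon_measures B"
  shows "emeasure \<mu> (topspace B - msupp B \<mu>) = 0"
proof -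
  let ?O = "topspace B - msupp B \<mu>"
  have "?O \<in> sets \<mu>" using closedin_msupp by (intro pos_radon_measuresD(3)[OF \<mu>]) auto
  then have "emeasure \<mu> ?O = (SUP K\<in>{K. compactin B K \<and> K \<subseteq> ?O}. emeasure \<mu> K)"
    by (rule pos_radon_measuresD(4)[OF \<mu>])
  also have "\<dots> \<le> 0"
  proof (rule SUP_least, clarify)
    fix K assume K: "compactin B K" "K \<subseteq> ?O"
    define \<U> where "\<U> = {U. openin B U \<and> emeasure \<mu> U = 0}"
    have "K \<subseteq> \<Union>\<U>"
    proof
      fix x assume "x \<in> K"
      then obtain U where "openin B U" "x \<in> U" "\<not> emeasure \<mu> U > 0"
        using K(2) unfolding msupp_def by blast
      then show "x \<in> \<Union>\<U>" by (auto simp: \<U>_def)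
    qed
    moreover have "openin B U" if "U \<in> \<U>" for U using that by (simp add: \<U>_def)
    ultimately obtain \<F> where \<F>: "finite \<F>" "\<F> \<subseteq> \<U>" "K \<subseteq> \<Union>\<F>"
      using compactinD[OF K(1), of \<U>] by blast
    have m: "U \<in> sets \<mu>" "emeasure \<mu> U = 0" if "U \<in> \<F>" for U
      using that \<F>(2) pos_radon_measuresD(3)[OF \<mu>] by (auto simp: \<U>_def)
    have "emeasure \<mu> K \<le> emeasure \<mu> (\<Union>U\<in>\<F>. U)"
      using \<F> m by (intro emeasure_mono) auto
    also have "\<dots> \<le> (\<Sum>U\<in>\<F>. emeasure \<mu> U)"
      using \<F>(1) m by (intro emeasure_subadditive_finite) auto
    also have "\<dots> = 0" using m by simp
    finally show "emeasure \<mu> K \<le> 0" .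
  qed
  finally show ?thesis by simp
qed

section \<open>Maps from the Stone-Cech compactification\<close>

text \<open>\<open>stone_cech\<close> only extends bounded real functions. Since K is regular, a
  K-valued map on the dense image extends as soon as it has a limit at every point of B, and real
  functions suffice to detect these limits.\<close>

lemma stone_cech_cont_extension:
  assumes sc: "stone_cech X e B" and K: "compact_space K" "Hausdorff_space K"
    and f: "continuous_map X K f"
  shows "continuous_map B K (cont_extension X e B K f)"
    and "x \<in> topspace X \<Longrightarrow> cont_extension X e B K f (e x) = f x"
proof -
  define S where "S = e ` topspace X"
  have emb: "embedding_map X B e" and dense: "B closure_of S = topspace B"
    and ext: "\<And>u. continuous_map X euclideanreal u \<Longrightarrow> bounded (u ` topspace X) \<Longrightarrow>
        \<exists>v. continuous_map B euclideanreal v \<and> (\<forall>x\<in>topspace X. v (e x) = u x)"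
    using sc by (auto simp: stone_cech_def compactification_def S_def)
  then obtain e' where e': "homeomorphic_maps X (subtopology B S) e e'"
    unfolding embedding_map_def homeomorphic_map_maps S_def by blast
  then have e'e: "e' (e x) = x" if "x \<in> topspace X" for x
    using that by (simp add: homeomorphic_maps_def)
  have normal: "normal_space K" and regular: "regular_space K"
    using K compact_Hausdorff_or_regular_imp_normal_space compact_Hausdorff_imp_regular_space by blast+
  define f' where "f' = f \<circ> e'"
  have f': "continuous_map (subtopology B S) K f'"
    unfolding f'_def using e' f by (auto simp: homeomorphic_maps_def intro: continuous_map_compose)
  have f'e: "f' (e x) = f x" if "x \<in> topspace X" for x using e'e[OF that] by (simp add: f'_def)
  have fK: "f x \<in> topspace K" if "x \<in> topspace X" for x
    using continuous_map_funspace[OF f] that by auto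
  \<comment> \<open>A cluster point of \<open>f'\<close> at \<open>t\<close> exists by compactness; it is a limit because, for Urysohn functions
    \<open>u\<close> on \<open>K\<close>, \<open>u \<circ> f\<close> extends continuously to \<open>t\<close>.\<close>
  have lim: "\<exists>l. limitin K f' l (atin_within B t S)" if t: "t \<in> topspace B" for t
  proof -
    have dense': "\<exists>x\<in>topspace X. e x \<in> U" if "openin B U" "t \<in> U" for U
      using dense t that by (metis S_def in_closure_of imageE)
    have "\<exists>l\<in>topspace K. \<forall>N U. openin K N \<and> l \<in> N \<and> openin B U \<and> t \<in> U \<longrightarrow>
            (\<exists>x\<in>topspace X. e x \<in> U \<and> f x \<in> N)"
    proof (rule ccontr)
      assume "\<not> ?thesis"
      then obtain N U where NU: "\<And>l. l \<in> topspace K \<Longrightarrow> openin K (N l) \<and> l \<in> N l \<and> openin B (U l) \<and> t \<in> U l"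
        "\<And>l x. l \<in> topspace K \<Longrightarrow> x \<in> topspace X \<Longrightarrow> e x \<in> U l \<Longrightarrow> f x \<notin> N l"
        by metis
      have "topspace K \<subseteq> \<Union>(N ` topspace K)" using NU(1) by blast
      then obtain \<F> where \<F>: "finite \<F>" "\<F> \<subseteq> N ` topspace K" "topspace K \<subseteq> \<Union>\<F>"
        using K(1)[unfolded compact_space_def] compactinD[of K "topspace K" "N ` topspace K"] NU(1)
        by (metis (no_types, lifting) imageE)
      then obtain L where L: "finite L" "L \<subseteq> topspace K" "\<F> = N ` L"
        by (meson finite_subset_image)
      \<comment> \<open>A finite intersection of the \<open>U l\<close> is a neighbourhood of t,
        hence contains some e(x); then f(x) would avoid every set of the finite cover of K.\<close>
      have "openin B ((\<Inter>l\<in>L. U l) \<inter> topspace B)"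
        using L NU(1) by (intro openin_INT) auto
      moreover have "t \<in> (\<Inter>l\<in>L. U l) \<inter> topspace B" using t L NU(1) by auto
      ultimately obtain x where x: "x \<in> topspace X" "e x \<in> (\<Inter>l\<in>L. U l) \<inter> topspace B"
        using dense' by blast
      obtain l where "l \<in> L" "f x \<in> N l" using fK[OF x(1)] \<F>(3) L by auto
      then show False using NU(2)[OF _ x(1)] x(2) L(2) by blast
    qed
    then obtain l where l: "l \<in> topspace K" and cluster:
      "\<And>N U. openin K N \<Longrightarrow> l \<in> N \<Longrightarrow> openin B U \<Longrightarrow> t \<in> U \<Longrightarrow> \<exists>x\<in>topspace X. e x \<in> U \<and> f x \<in> N"
      by metis
    have "limitin K f' l (atin_within B t S)"
      unfolding limitin_def
    proof (intro conjI allI impI l)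
      fix N assume N: "openin K N \<and> l \<in> N"
      have "closedin K {l}" using K(2) l by (simp add: Hausdorff_imp_t1_space closedin_t1_singleton)
      moreover have "closedin K (topspace K - N)" using N by auto
      ultimately obtain u where u: "continuous_map K (top_of_set {0..1::real}) u"
        "u ` {l} \<subseteq> {0}" "u ` (topspace K - N) \<subseteq> {1}"
        using Urysohn_lemma[OF normal, of "{l}" "topspace K - N" 0 1] N by (auto simp: disjnt_def)
      have uc: "continuous_map K euclideanreal u" and u01: "u \<in> topspace K \<rightarrow> {0..1}"
        using u by (simp_all add: continuous_map_in_subtopology image_subset_iff_funcset)
      have "bounded ((u \<circ> f) ` topspace X)"
        unfolding bounded_iff using u01 fK by (intro exI[of _ 1]) (fastforce simp: Pi_iff)
      then obtain v where v: "continuous_map B euclideanreal v" "\<And>x. x \<in> topspace X \<Longrightarrow> v (e x) = u (f x)"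
        using ext[OF continuous_map_compose[OF f uc]] by auto
      \<comment> \<open>u is 0 at l and 1 off N. If v(t) exceeded 1/4, the cluster property would
        give a point with u(f(x)) < 1/4 < v(e(x)), although the two values coincide. Then v < 1/2
        near t, which keeps f' inside N.\<close>
      have "v t \<le> 1/4"
      proof (rule ccontr)
        assume "\<not> v t \<le> 1/4"
        then obtain x where "x \<in> topspace X" "v (e x) > 1/4" "u (f x) < 1/4"
          using cluster[of "{k \<in> topspace K. u k \<in> {..<1/4}}" "{b \<in> topspace B. v b \<in> {1/4<..}}"]
            openin_continuous_map_preimage[OF uc, of "{..<1/4}"] u(2) l t
            openin_continuous_map_preimage[OF v(1), of "{1/4<..}"] by auto
        then show False using v(2) by auto
      qed
      then have t': "t \<in> {b \<in> topspace B. v b \<in> {..<1/2}}" using t by auto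
      show "\<forall>\<^sub>F x in atin_within B t S. f' x \<in> N"
        unfolding eventually_atin_within
      proof (rule disjI2, intro conjI t exI ballI impI)
        show "openin B {b \<in> topspace B. v b \<in> {..<1/2}}"
          by (rule openin_continuous_map_preimage[OF v(1)]) simp
        fix b assume b: "b \<in> {b \<in> topspace B. v b \<in> {..<1/2}}" "b \<in> S \<and> b \<noteq> t"
        then obtain x where x: "x \<in> topspace X" "b = e x" by (auto simp: S_def)
        then have "u (f x) < 1/2" using b v(2) by auto
        then show "f' b \<in> N" using u(3) fK[OF x(1)] f'e[OF x(1)] x(2) by force
      qed (rule t')
    qed
    then show ?thesis ..
  qed
  have "S \<subseteq> topspace B"
    using emb by (auto simp: S_def embedding_map_def dest!: homeomorphic_imp_surjective_map)
  then obtain g where "continuous_map (subtopology B (topspace B)) K g" "\<And>b. b \<in> S \<Longrightarrow> g b = f' b"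
    using continuous_map_extension_pointwise_alt[OF regular, of S "topspace B" B f'] dense f' lim
    by (metis DiffD1 order_refl)
  then have "\<exists>g. continuous_map B K g \<and> (\<forall>x\<in>topspace X. g (e x) = f x)"
    using f'e by (auto simp: S_def)
  then have "continuous_map B K (cont_extension X e B K f) \<and>
      (\<forall>x\<in>topspace X. cont_extension X e B K f (e x) = f x)"
    unfolding cont_extension_def by (rule someI_ex)
  then show "continuous_map B K (cont_extension X e B K f)"
    "x \<in> topspace X \<Longrightarrow> cont_extension X e B K f (e x) = f x" by auto
qed

text \<open>As open W shrinks to T, the set of points with both coordinates in W shrinks to the set
  with both in T. The latter misses the compact set C, so some W already does. Here it turns
  information about E into information about a neighbourhood of T.\<close>

lemma nhd_of_preimages:
  assumes B: "compact_space B" and K: "compact_space K" "Hausdorff_space K"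
    and p: "continuous_map B K p1" "continuous_map B K p2" and T: "closedin K T"
    and C: "closedin B C" "\<And>\<xi>. \<xi> \<in> C \<Longrightarrow> p1 \<xi> \<notin> T \<or> p2 \<xi> \<notin> T"
  obtains W where "openin K W" "T \<subseteq> W" "\<And>\<xi>. \<xi> \<in> C \<Longrightarrow> p1 \<xi> \<notin> W \<or> p2 \<xi> \<notin> W"
proof -
  have "regular_space K" using K compact_Hausdorff_imp_regular_space by blast
  then have sep: "\<exists>W V. openin K W \<and> openin K V \<and> T \<subseteq> W \<and> k \<in> V \<and> disjnt V W"
    if "k \<in> topspace K - T" for k
    using that T unfolding regular_space_def by metis
  have "\<exists>W N. openin K W \<and> T \<subseteq> W \<and> openin B N \<and> \<xi> \<in> N \<and> (\<forall>\<eta>\<in>N. p1 \<eta> \<notin> W \<or> p2 \<eta> \<notin> W)"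
    if \<xi>: "\<xi> \<in> C" for \<xi>
  proof -
    have \<xi>B: "\<xi> \<in> topspace B" using closedin_subset[OF C(1)] \<xi> by auto
    obtain r where r: "r = p1 \<or> r = p2" "r \<xi> \<notin> T" using C(2)[OF \<xi>] by blast
    then have rc: "continuous_map B K r" using p by auto
    then have "r \<xi> \<in> topspace K - T" using r(2) \<xi>B continuous_map_funspace[OF rc] by auto
    then obtain W V where WV: "openin K W" "openin K V" "T \<subseteq> W" "r \<xi> \<in> V" "disjnt V W"
      using sep by metis
    have "openin B {\<eta> \<in> topspace B. r \<eta> \<in> V}"
      by (rule openin_continuous_map_preimage[OF rc WV(2)])
    moreover have "\<forall>\<eta>\<in>{\<eta> \<in> topspace B. r \<eta> \<in> V}. p1 \<eta> \<notin> W \<or> p2 \<eta> \<notin> W"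
      using r(1) WV(5) by (auto simp: disjnt_def)
    ultimately show ?thesis using WV \<xi>B by blast
  qed
  then obtain W N where WN: "\<And>\<xi>. \<xi> \<in> C \<Longrightarrow> openin K (W \<xi>) \<and> T \<subseteq> W \<xi> \<and> openin B (N \<xi>) \<and> \<xi> \<in> N \<xi>"
    "\<And>\<xi> \<eta>. \<xi> \<in> C \<Longrightarrow> \<eta> \<in> N \<xi> \<Longrightarrow> p1 \<eta> \<notin> W \<xi> \<or> p2 \<eta> \<notin> W \<xi>"
    by metis
  have "C \<subseteq> \<Union>(N ` C)" "\<And>U. U \<in> N ` C \<Longrightarrow> openin B U" using WN(1) by auto
  then obtain \<F> where \<F>: "finite \<F>" "\<F> \<subseteq> N ` C" "C \<subseteq> \<Union>\<F>"
    using compactinD[OF closedin_compact_space[OF B C(1)], of "N ` C"] by blast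
  then obtain D where D: "finite D" "D \<subseteq> C" "\<F> = N ` D"
    by (meson finite_subset_image)
  show thesis
  proof
    \<comment> \<open>For empty D the bare intersection would be \<open>UNIV\<close>; cutting with
      the whole space keeps it open in K.\<close>
    show "openin K ((\<Inter>\<xi>\<in>D. W \<xi>) \<inter> topspace K)"
      using D WN(1) by (intro openin_INT) auto
    show "T \<subseteq> (\<Inter>\<xi>\<in>D. W \<xi>) \<inter> topspace K"
      using D WN(1) closedin_subset[OF T] by blast
    fix \<eta> assume "\<eta> \<in> C"
    then obtain \<xi> where "\<xi> \<in> D" "\<eta> \<in> N \<xi>" using \<F>(3) D(3) by auto
    then show "p1 \<eta> \<notin> (\<Inter>\<xi>\<in>D. W \<xi>) \<inter> topspace K \<or> p2 \<eta> \<notin> (\<Inter>\<xi>\<in>D. W \<xi>) \<inter> topspace K"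
      using WN(2)[of \<xi> \<eta>] D(2) by blast
  qed
qed

section \<open>Determining sets and the extended support\<close>

definition determining :: "('a::{metric_space, zero} lip0 \<Rightarrow>\<^sub>L real) \<Rightarrow> 'a set \<Rightarrow> bool" where
  "determining \<phi> A \<longleftrightarrow> (\<forall>f. (\<forall>x\<in>A. lip_fun f x = 0) \<longrightarrow> blinfun_apply \<phi> f = 0)"

lemma ext_support_alt: "ext_support i K \<phi> = \<Inter> {K closure_of (i ` A) | A. determining \<phi> A}"
  by (simp add: ext_support_def determining_def)

lemma determining_UNIV: "determining \<phi> UNIV"
proof -
  have "f = 0" if "\<forall>x\<in>UNIV. lip_fun f x = 0" for f :: "'a lip0"
    using that by (metis UNIV_I ext lip_fun_inject zero_lip0.rep_eq)
  then show ?thesis unfolding determining_def by (metis blinfun.zero_right)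
qed

lemma determining_eq:
  assumes "determining \<phi> A" "\<And>x. x \<in> A \<Longrightarrow> lip_fun f x = lip_fun g x"
  shows "blinfun_apply \<phi> f = blinfun_apply \<phi> g"
proof -
  have "blinfun_apply \<phi> (f - g) = 0"
    using assms by (auto simp: determining_def minus_lip0.rep_eq)
  then show ?thesis by (simp add: blinfun.diff_right)
qed

lemma samuelD:
  assumes "samuel i K"
  shows "compact_space K" "Hausdorff_space K" "continuous_map euclidean K i"
    "i x \<in> topspace K" "K closure_of (range i) = topspace K"
    "K closure_of (i ` A) \<inter> K closure_of (i ` B) = {} \<longleftrightarrow> (\<exists>\<delta>>0. \<forall>a\<in>A. \<forall>b\<in>B. \<delta> \<le> dist a b)"
proof -
  have c: "compactification euclidean i K" using assms by (simp add: samuel_def)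
  then show "compact_space K" "Hausdorff_space K" "K closure_of (range i) = topspace K"
    by (simp_all add: compactification_def)
  show "continuous_map euclidean K i"
    using c homeomorphic_imp_continuous_map
    by (force simp: compactification_def embedding_map_def continuous_map_in_subtopology)
  then show "i x \<in> topspace K" using continuous_map_funspace by fastforce
  show "K closure_of (i ` A) \<inter> K closure_of (i ` B) = {} \<longleftrightarrow> (\<exists>\<delta>>0. \<forall>a\<in>A. \<forall>b\<in>B. \<delta> \<le> dist a b)"
    using assms unfolding samuel_def by blast
qed

text \<open>A bounded \<open>f\<close> vanishing near \<open>cl A \<inter> cl C\<close> agrees on \<open>C\<close> with a Lipschitz function vanishing
  on \<open>A\<close>, since \<open>A\<close> and \<open>C\<close> are at positive distance where \<open>f\<close> is nonzero.\<close>

lemma determining_Int_bounded: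
  assumes sam: "samuel i K" and A: "determining \<phi> A" and C: "determining \<phi> C"
    and W: "openin K W" "K closure_of (i ` A) \<inter> K closure_of (i ` C) \<subseteq> W"
    and f: "\<And>x. i x \<in> W \<Longrightarrow> lip_fun f x = 0" and b: "\<And>x. \<bar>lip_fun f x\<bar> \<le> b"
  shows "blinfun_apply \<phi> f = 0"
proof -
  define A' C' where "A' = {x\<in>A. i x \<notin> W}" and "C' = {x\<in>C. i x \<notin> W}"
  have far: "K closure_of (i ` {x\<in>D. i x \<notin> W}) \<subseteq> K closure_of (i ` D) \<inter> (topspace K - W)" for D
  proof -
    have "K closure_of (i ` {x\<in>D. i x \<notin> W}) \<subseteq> topspace K - W"
      by (rule closure_of_minimal) (use W(1) samuelD(4)[OF sam] in auto)
    moreover have "K closure_of (i ` {x\<in>D. i x \<notin> W}) \<subseteq> K closure_of (i ` D)"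
      by (rule closure_of_mono) auto
    ultimately show ?thesis by blast
  qed
  have "K closure_of (i ` A') \<inter> K closure_of (i ` C') = {}"
    using far[of A] far[of C] W(2) unfolding A'_def C'_def by blast
  then obtain \<delta> where \<delta>: "\<delta> > 0" "\<And>x y. x \<in> A' \<Longrightarrow> y \<in> C' \<Longrightarrow> \<delta> \<le> dist x y"
    unfolding samuelD(6)[OF sam] by blast
  have b0: "0 \<le> b" using b[of 0] by simp
  \<comment> \<open>The summand \<open>norm f\<close> serves pairs at which the slope of f itself
    suffices. For x in A' and y in C' the values 0 and f(y) differ by at most b over a distance of
    at least \<delta>, which costs b / \<delta>.\<close>
  define L where "L = norm f + b / \<delta>"
  have L: "norm f \<le> L" "b / \<delta> \<le> L" "0 \<le> L" using b0 \<delta> by (auto simp: L_def)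
  define g where "g x = (if x \<in> C then lip_fun f x else 0)" for x
  have gA: "g x = 0" if "x \<in> A \<union> {0}" "x \<notin> C \<or> i x \<in> W \<or> x = 0" for x
    using that f by (auto simp: g_def)
  have lip: "\<bar>lip_fun f x - lip_fun f y\<bar> \<le> L * dist x y" for x y
    using lipschitz_onD[OF norm_lip0_lipschitz, of x y f] mult_right_mono[OF L(1), of "dist x y"]
    by (simp add: dist_real_def)
  \<comment> \<open>So a point of both A and C lies in W, where f vanishes; the two prescriptions
    for g, namely f on C and 0 on A, are therefore compatible.\<close>
  have disj: "A' \<inter> C' = {}" using \<delta> by force
  have near: "\<bar>lip_fun f y\<bar> \<le> L * dist x y" if "x \<in> A \<union> {0}" "y \<in> C" for x y
  proof (cases "i y \<in> W \<or> i x \<in> W \<or> x = 0")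
    case True
    then show ?thesis using lip[of x y] f L(3) by auto
  next
    case False
    then have "\<delta> \<le> dist x y" using that by (intro \<delta>(2)) (auto simp: A'_def C'_def)
    then have "b / \<delta> * \<delta> \<le> L * dist x y" using L \<delta> by (intro mult_mono) auto
    then show ?thesis using b[of y] \<delta> by simp
  qed
  have "L-lipschitz_on (A \<union> C \<union> {0}) g"
  proof (rule lipschitz_onI[OF _ L(3)])
    fix x y assume xy: "x \<in> A \<union> C \<union> {0}" "y \<in> A \<union> C \<union> {0}"
    show "dist (g x) (g y) \<le> L * dist x y"
      using near[of x y] near[of y x] lip[of x y] L(3) xy
      by (auto simp: g_def dist_real_def dist_commute)
  qed
  moreover have "g 0 = 0" by (simp add: g_def)
  ultimately obtain h where h: "\<And>x. x \<in> A \<union> C \<union> {0} \<Longrightarrow> lip_fun h x = g x"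
    using lip0_extension[of L "A \<union> C \<union> {0}" g] by blast
  have "blinfun_apply \<phi> f = blinfun_apply \<phi> h"
    by (rule determining_eq[OF C]) (simp add: h g_def)
  also have "\<dots> = 0"
  proof -
    have "lip_fun h x = 0" if "x \<in> A" for x
      using h[of x] that disj f by (auto simp: g_def A'_def C'_def)
    then show ?thesis using A by (simp add: determining_def)
  qed
  finally show ?thesis .
qed

text \<open>The product of f with \<open>h_cut n\<close> is bounded, having bounded support, and
  vanishes wherever f does. The bounded case applies to it, and the limit over n gives
  \<phi>(f).\<close>

lemma determining_Int:
  assumes sam: "samuel i K" and \<phi>: "avoids_infinity \<phi>"
    and A: "determining \<phi> A" and C: "determining \<phi> C"
    and W: "openin K W" "K closure_of (i ` A) \<inter> K closure_of (i ` C) \<subseteq> W"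
  shows "determining \<phi> {x. i x \<in> W}"
  unfolding determining_def
proof (intro allI impI)
  fix f assume f: "\<forall>x\<in>{x. i x \<in> W}. lip_fun f x = 0"
  have "blinfun_apply (\<phi> o\<^sub>L W_cut n) f = 0" for n
  proof -
    have eq: "lip_fun (blinfun_apply (W_cut n) f) x = lip_fun f x * h_cut n x" for x
      by (simp add: W_cut.rep_eq h_cut_mult.rep_eq)
    \<comment> \<open>A crude radius larger than both thresholds in \<open>h_cut\<close>, so that
      beyond it both tests fail and the value is 0.\<close>
    define r :: real where "r = 2 powi n + 2 powi (n + 1)"
    have "\<bar>lip_fun f x * h_cut n x\<bar> \<le> norm f * r" for x
    proof (cases "dist x 0 \<le> r")
      case True
      have "\<bar>lip_fun f x\<bar> \<le> norm f * dist x 0"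
        using lipschitz_onD[OF norm_lip0_lipschitz, of x 0 f] by (simp add: dist_real_def)
      also have "\<dots> \<le> norm f * r" using True by (intro mult_left_mono) auto
      finally have "\<bar>lip_fun f x\<bar> * \<bar>h_cut n x\<bar> \<le> norm f * r * 1"
        by (intro mult_mono) (auto simp: h_cut_alt r_def)
      then show ?thesis by (simp add: abs_mult)
    next
      case False
      moreover have "(0::real) < 2 powi n" "(0::real) < 2 powi (n + 1)" by simp_all
      ultimately have "\<not> dist x 0 \<le> 2 powi n" "\<not> dist x 0 \<le> 2 powi (n + 1)"
        unfolding r_def by linarith+
      then have "h_cut n x = 0" by (simp only: h_cut_def if_False)
      then show ?thesis by (simp add: r_def)
    qed
    then have "blinfun_apply \<phi> (blinfun_apply (W_cut n) f) = 0"
      using f by (intro determining_Int_bounded[OF sam A C W, of _ "norm f * r"]) (auto simp: eq)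
    then show ?thesis by simp
  qed
  moreover have "((\<lambda>n. blinfun_apply (\<phi> o\<^sub>L W_cut n) f) \<longlongrightarrow> blinfun_apply \<phi> f) at_top"
    using \<phi> unfolding avoids_infinity_def by (intro blinfun.tendsto tendsto_const)
  ultimately have "((\<lambda>n::int. 0) \<longlongrightarrow> blinfun_apply \<phi> f) at_top" by simp
  then show "blinfun_apply \<phi> f = 0" by (simp add: tendsto_const_iff)
qed

text \<open>The induction hypothesis provides only neighbourhoods of the smaller intersection, and
  the closure of one might be too large. Normality yields a U whose closure misses the part of cl A
  outside W, and then the case of two sets applies to A and U.\<close>

lemma determining_Inter:
  assumes sam: "samuel i K" and \<phi>: "avoids_infinity \<phi>"
    and "finite \<A>" "\<A> \<noteq> {}" "\<And>A. A \<in> \<A> \<Longrightarrow> determining \<phi> A"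
    and "openin K W" "(\<Inter>A\<in>\<A>. K closure_of (i ` A)) \<subseteq> W"
  shows "determining \<phi> {x. i x \<in> W}"
  using assms(3-)
proof (induction \<A> arbitrary: W rule: finite_ne_induct)
  case (singleton A)
  then show ?case by (intro determining_Int[OF sam \<phi>, of A A]) auto
next
  case (insert A \<A>)
  let ?D = "\<Inter>A\<in>\<A>. K closure_of (i ` A)"
  have "closedin K ?D" using insert.hyps by (intro closedin_INT) auto
  moreover have "closedin K (K closure_of (i ` A) - W)"
    using insert.prems(2) by auto
  moreover have "disjnt ?D (K closure_of (i ` A) - W)"
    using insert.prems(3) by (auto simp: disjnt_def)
  moreover have "normal_space K"
    using samuelD(1,2)[OF sam] compact_Hausdorff_or_regular_imp_normal_space by blast
  ultimately obtain U V where UV: "openin K U" "openin K V" "?D \<subseteq> U" "K closure_of (i ` A) - W \<subseteq> V" "disjnt U V"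
    unfolding normal_space_def by metis
  have U: "determining \<phi> {x. i x \<in> U}"
    using UV insert.prems(1) by (intro insert.IH) auto
  have "K closure_of (i ` {x. i x \<in> U}) \<subseteq> topspace K - V"
    by (rule closure_of_minimal) (use UV openin_subset[OF UV(1)] in \<open>auto simp: disjnt_def\<close>)
  then have "K closure_of (i ` A) \<inter> K closure_of (i ` {x. i x \<in> U}) \<subseteq> W"
    using UV(4) by auto
  then show ?case
    using insert.prems by (intro determining_Int[OF sam \<phi> _ U]) auto
qed

text \<open>The complement of W is compact, so finitely many of the closures defining the extended
  support already intersect inside W.\<close>

lemma determining_nhd_ext_support:
  assumes sam: "samuel i K" and \<phi>: "avoids_infinity \<phi>"
    and W: "openin K W" "ext_support i K \<phi> \<subseteq> W"
  shows "determining \<phi> {x. i x \<in> W}"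
proof -
  define \<A> where "\<A> = {A. determining \<phi> A}"
  define co where "co A = topspace K - K closure_of (i ` A)" for A
  have cpt: "compactin K (topspace K - W)"
    using closedin_compact_space[OF samuelD(1)[OF sam]] W(1) by auto
  have "U \<in> co ` \<A> \<Longrightarrow> openin K U" for U
    by (auto simp: co_def)
  moreover have "topspace K - W \<subseteq> \<Union>(co ` \<A>)"
    using W(2) by (auto simp: ext_support_alt co_def \<A>_def)
  ultimately obtain \<F> where \<F>: "finite \<F>" "\<F> \<subseteq> co ` \<A>" "topspace K - W \<subseteq> \<Union>\<F>"
    using compactinD[OF cpt, of "co ` \<A>"] by blast
  then obtain \<B> where \<B>: "finite \<B>" "\<B> \<subseteq> \<A>" "\<F> = co ` \<B>"
    by (meson finite_subset_image)
  show ?thesis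
  proof (rule determining_Inter[OF sam \<phi> _ _ _ W(1)])
    \<comment> \<open>\<open>UNIV\<close> is determining and its image is dense; adding it keeps the
      family nonempty when W is the whole space.\<close>
    show "finite (insert UNIV \<B>)" using \<B> by simp
    show "determining \<phi> A" if "A \<in> insert UNIV \<B>" for A
      using that \<B> determining_UNIV by (auto simp: \<A>_def)
    show "(\<Inter>A\<in>insert UNIV \<B>. K closure_of (i ` A)) \<subseteq> W"
      using \<F>(3) \<B>(3) samuelD(5)[OF sam] by (auto simp: co_def)
  qed simp
qed

lemma ext_support_closedin:
  assumes "samuel i K"
  shows "closedin K (ext_support i K \<phi>)"
  unfolding ext_support_alt using determining_UNIV by (intro closedin_Inter) auto

text \<open>\<phi> cannot distinguish f from an extension of its restriction to A with norm at most
  s. The one-sided bound on slopes suffices because x and y may be swapped.\<close>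

lemma determining_bound:
  fixes f :: "'a::{metric_space, zero} lip0"
  assumes A: "determining \<phi> A" "0 \<in> A" and s: "0 \<le> s"
    and le: "\<And>x y. x \<in> A \<Longrightarrow> y \<in> A \<Longrightarrow> x \<noteq> y \<Longrightarrow> (lip_fun f x - lip_fun f y) / dist x y \<le> s"
  shows "blinfun_apply \<phi> f \<le> norm \<phi> * s"
proof -
  have *: "lip_fun f x - lip_fun f y \<le> s * dist x y" if "x \<in> A" "y \<in> A" for x y
    using le[OF that] by (cases "x = y") (auto simp: field_simps)
  have "s-lipschitz_on A (lip_fun f)"
  proof (rule lipschitz_onI[OF _ s])
    fix x y assume "x \<in> A" "y \<in> A"
    then show "dist (lip_fun f x) (lip_fun f y) \<le> s * dist x y"
      using *[of x y] *[of y x] by (simp add: dist_real_def dist_commute abs_le_iff)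
  qed
  then obtain h :: "'a lip0" where h: "norm h \<le> s" "\<And>x. x \<in> A \<Longrightarrow> lip_fun h x = lip_fun f x"
    using lip0_extension[of s A "lip_fun f"] A(2) by auto
  have "blinfun_apply \<phi> f = blinfun_apply \<phi> h"
    by (rule determining_eq[OF A(1)]) (simp add: h(2))
  also have "\<dots> \<le> norm \<phi> * norm h" using norm_blinfun[of \<phi> h] by simp
  also have "\<dots> \<le> norm \<phi> * s" using h(1) by (intro mult_left_mono) auto
  finally show ?thesis .
qed

section \<open>Optimal representation\<close>

lemma norm_Phi_adj_le:
  assumes sc: "stone_cech offdiag e B" and \<mu>: "\<mu> \<in> pos_radon_measures B"
  shows "norm (Phi_adj e B \<mu>) \<le> measure \<mu> (space \<mu>)"
proof (rule norm_blinfun_bound)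
  interpret finite_measure \<mu> by (rule pos_radon_measuresD(2)[OF \<mu>])
  fix f
  have "norm (\<integral>\<xi>. Phi e B f \<xi> \<partial>\<mu>) \<le> (\<integral>\<xi>. norm (Phi e B f \<xi>) \<partial>\<mu>)"
    by (rule integral_norm_bound)
  also have "\<dots> \<le> (\<integral>\<xi>. norm f \<partial>\<mu>)"
    by (rule integral_mono') (use Phi_works(3)[OF sc] pos_radon_measuresD(1)[OF \<mu>] in auto)
  finally show "norm (blinfun_apply (Phi_adj e B \<mu>) f) \<le> measure \<mu> (space \<mu>) * norm f"
    by (simp add: Phi_adj_apply[OF sc \<mu>] mult.commute)
qed simp

theorem proposition5p4:
  fixes \<phi> :: "'a::{complete_space, zero} lip0 \<Rightarrow>\<^sub>L real"
    and e :: "'a \<times> 'a \<Rightarrow> 'b" and B :: "'b topology"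
    and i :: "'a \<Rightarrow> 'k" and K :: "'k topology"
  assumes "stone_cech offdiag e B"
    and "samuel i K"
    and "avoids_infinity \<phi>"
  shows "\<exists>\<mu>\<in>M_op e B.
           Phi_adj e B \<mu> = \<phi> \<and>
           ext_support i K \<phi> \<subseteq> shadow e B i K (msupp B \<mu>) \<and>
           shadow e B i K (msupp B \<mu>) \<subseteq> ext_support i K \<phi> \<union> {i 0}"
proof -
  note sc = assms(1) and sam = assms(2)
  have B: "compact_space B" "Hausdorff_space B"
    and eB: "embedding_map offdiag B e"
    and dense: "B closure_of (e ` {(x, y). x \<noteq> y}) = topspace B"
    using sc by (auto simp: stone_cech_def compactification_def)
  note K = samuelD(1,2)[OF sam]
  have coord: "continuous_map offdiag K (\<lambda>z. i (g z))" if "continuous_on UNIV g"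
    for g :: "'a \<times> 'a \<Rightarrow> 'a"
  proof -
    have "continuous_map offdiag euclidean g"
      using continuous_on_subset[OF that] by (simp add: offdiag_def)
    from continuous_map_compose[OF this samuelD(3)[OF sam]] show ?thesis by (simp add: o_def)
  qed
  define p1 p2 where "p1 = cont_extension offdiag e B K (\<lambda>(x, y). i x)"
    and "p2 = cont_extension offdiag e B K (\<lambda>(x, y). i y)"
  have c1: "continuous_map offdiag K (\<lambda>(x, y). i x)"
    and c2: "continuous_map offdiag K (\<lambda>(x, y). i y)"
    using coord[OF continuous_on_fst[OF continuous_on_id]] coord[OF continuous_on_snd[OF continuous_on_id]]
    by (simp_all add: case_prod_unfold)
  have p: "continuous_map B K p1" "continuous_map B K p2"
    and pe: "\<And>x y. x \<noteq> y \<Longrightarrow> p1 (e (x, y)) = i x" "\<And>x y. x \<noteq> y \<Longrightarrow> p2 (e (x, y)) = i y"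
    using stone_cech_cont_extension[OF sc K c1] stone_cech_cont_extension[OF sc K c2]
    unfolding p1_def p2_def by auto
  have shadow_eq: "shadow e B i K F = p1 ` F \<union> p2 ` F" for F
    by (simp add: shadow_def p1_def p2_def)
  have pB: "p1 \<xi> \<in> topspace K" "p2 \<xi> \<in> topspace K" if "\<xi> \<in> topspace B" for \<xi>
    using continuous_map_funspace[OF p(1)] continuous_map_funspace[OF p(2)] that by auto
  have dense': "\<exists>x y. x \<noteq> y \<and> e (x, y) \<in> U" if "openin B U" "\<xi> \<in> U" for U \<xi>
  proof -
    have "\<xi> \<in> B closure_of (e ` {(x, y). x \<noteq> y})"
      using dense openin_subset[OF that(1)] that(2) by auto
    then show ?thesis using that unfolding in_closure_of by blast
  qed
  have eB': "e (x, y) \<in> topspace B" if "x \<noteq> y" for x y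
    using homeomorphic_imp_surjective_map[OF eB[unfolded embedding_map_def]] that by auto

  define S where "S = ext_support i K \<phi>"
  define T where "T = insert (i 0) S"
  have T: "closedin K T"
  proof -
    have "closedin K {i 0}"
      using samuelD(4)[OF sam] Hausdorff_imp_t1_space[OF K(2)] by (simp add: closedin_t1_singleton)
    then have "closedin K ({i 0} \<union> S)"
      unfolding S_def by (intro closedin_Un ext_support_closedin[OF sam])
    then show ?thesis by (simp add: T_def)
  qed
  define E where "E = {\<xi> \<in> topspace B. p1 \<xi> \<in> T} \<inter> {\<xi> \<in> topspace B. p2 \<xi> \<in> T}"
  have E: "closedin B E"
    unfolding E_def
    by (rule closedin_Int[OF closedin_continuous_map_preimage[OF p(1) T] closedin_continuous_map_preimage[OF p(2) T]])

  \<comment> \<open>The strict inequality on E makes the closed set where \<open>Phi e B f\<close>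
    is at least s disjoint from E, as compactness requires. The weak inequality is reached
    afterwards by enlarging s a little.\<close>
  have close: "blinfun_apply \<phi> f \<le> norm \<phi> * s"
    if s: "0 \<le> s" "\<And>\<xi>. \<xi> \<in> E \<Longrightarrow> Phi e B f \<xi> < s" for f s
  proof -
    let ?C = "{\<xi> \<in> topspace B. Phi e B f \<xi> \<in> {s..}}"
    have "closedin B ?C"
      by (rule closedin_continuous_map_preimage[OF Phi_works(1)[OF sc]]) simp
    moreover have "p1 \<xi> \<notin> T \<or> p2 \<xi> \<notin> T" if "\<xi> \<in> ?C" for \<xi>
      using that s(2)[of \<xi>] by (auto simp: E_def)
    ultimately obtain W where W: "openin K W" "T \<subseteq> W" "\<And>\<xi>. \<xi> \<in> ?C \<Longrightarrow> p1 \<xi> \<notin> W \<or> p2 \<xi> \<notin> W"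
      using nhd_of_preimages[OF B(1) K p T, of ?C] by blast
    show ?thesis
    proof (rule determining_bound)
      show "determining \<phi> {x. i x \<in> W}"
        using W by (intro determining_nhd_ext_support[OF sam assms(3)]) (auto simp: T_def S_def)
      show "0 \<in> {x. i x \<in> W}" using W(2) by (auto simp: T_def)
      fix x y assume xy: "x \<in> {x. i x \<in> W}" "y \<in> {x. i x \<in> W}" "x \<noteq> y"
      then have "e (x, y) \<notin> ?C" using W(3)[of "e (x, y)"] pe by auto
      then show "(lip_fun f x - lip_fun f y) / dist x y \<le> s"
        using eB'[OF xy(3)] Phi_works(2)[OF sc xy(3), of f] by auto
    qed (rule s(1))
  qed
  have bound: "blinfun_apply \<phi> f \<le> norm \<phi> * s"
    if s: "0 \<le> s" "\<And>\<xi>. \<xi> \<in> E \<Longrightarrow> Phi e B f \<xi> \<le> s" for f s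
  proof (rule field_le_epsilon)
    fix \<epsilon> :: real assume \<epsilon>: "0 < \<epsilon>"
    define \<delta> where "\<delta> = \<epsilon> / (norm \<phi> + 1)"
    have n: "norm \<phi> + 1 > 0" using norm_ge_zero[of \<phi>] by linarith
    then have \<delta>: "\<delta> > 0" using \<epsilon> by (simp add: \<delta>_def)
    have "norm \<phi> * \<delta> \<le> (norm \<phi> + 1) * \<delta>" using \<delta> by (intro mult_right_mono) auto
    also have "\<dots> = \<epsilon>" using n by (simp add: \<delta>_def)
    finally have "norm \<phi> * \<delta> \<le> \<epsilon>" .
    moreover have "blinfun_apply \<phi> f \<le> norm \<phi> * (s + \<delta>)"
      using s \<delta> by (intro close) force+
    ultimately show "blinfun_apply \<phi> f \<le> norm \<phi> * s + \<epsilon>" by (simp add: algebra_simps)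
  qed

  \<comment> \<open>\<open>Phi\<close> is a choice of extension, with no control off the topspace of
    B. Setting it to 0 there makes the dependence on f linear as an identity of total
    functions.\<close>
  define \<Psi> where "\<Psi> f \<xi> = (if \<xi> \<in> topspace B then Phi e B f \<xi> else 0)" for f \<xi>
  have eqI: "g \<xi> = k \<xi>" if "\<xi> \<in> topspace B" "continuous_map B euclideanreal g"
    "continuous_map B euclideanreal k" "\<And>x y. x \<noteq> y \<Longrightarrow> g (e (x, y)) = k (e (x, y))" for g k \<xi>
    by (rule forall_in_closure_of_eq[of \<xi> B "e ` {(x, y). x \<noteq> y}" euclideanreal g k])
      (use that dense in auto)
  have \<Psi>c: "continuous_map B euclideanreal (\<Psi> f)" for f
    by (rule continuous_map_eq[OF Phi_works(1)[OF sc, of f]]) (simp add: \<Psi>_def)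
  have \<Psi>_add: "\<Psi> (f + g) = (\<lambda>\<xi>. \<Psi> f \<xi> + \<Psi> g \<xi>)" for f g
  proof
    fix \<xi>
    have "Phi e B (f + g) \<xi> = Phi e B f \<xi> + Phi e B g \<xi>" if "\<xi> \<in> topspace B"
      using that by (rule eqI)
        (auto intro!: Phi_works[OF sc] continuous_map_add
          simp: Phi_works(2)[OF sc] plus_lip0.rep_eq diff_divide_distrib add_divide_distrib)
    then show "\<Psi> (f + g) \<xi> = \<Psi> f \<xi> + \<Psi> g \<xi>" by (simp add: \<Psi>_def)
  qed
  have \<Psi>_scale: "\<Psi> (r *\<^sub>R f) = (\<lambda>\<xi>. r * \<Psi> f \<xi>)" for r f
  proof
    fix \<xi>
    have "Phi e B (r *\<^sub>R f) \<xi> = r * Phi e B f \<xi>" if "\<xi> \<in> topspace B"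
      using that by (rule eqI)
        (auto intro!: Phi_works[OF sc] continuous_map_real_mult_left
          simp: Phi_works(2)[OF sc] scaleR_lip0.rep_eq right_diff_distrib diff_divide_distrib)
    then show "\<Psi> (r *\<^sub>R f) \<xi> = r * \<Psi> f \<xi>" by (simp add: \<Psi>_def)
  qed
  have "blinfun_apply \<phi> f \<le> norm \<phi> * s" if "0 \<le> s" "\<And>\<xi>. \<xi> \<in> E \<Longrightarrow> \<Psi> f \<xi> \<le> s" for f s
  proof (rule bound[OF that(1)])
    show "Phi e B f \<xi> \<le> s" if "\<xi> \<in> E" for \<xi>
      using \<open>\<And>\<xi>. \<xi> \<in> E \<Longrightarrow> \<Psi> f \<xi> \<le> s\<close>[OF that] closedin_subset[OF E] that
      by (auto simp: \<Psi>_def)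
  qed
  then obtain \<mu> where \<mu>: "\<mu> \<in> pos_radon_measures B" "measure \<mu> (topspace B) \<le> norm \<phi>"
    "\<And>f. (\<integral>x. \<Psi> f x \<partial>\<mu>) = blinfun_apply \<phi> f" "msupp B \<mu> \<subseteq> E"
    using radon_representation_on_closed[OF B E norm_ge_zero \<Psi>c \<Psi>_add \<Psi>_scale
        bounded_linear.linear[OF blinfun.bounded_linear_right[of \<phi>]]] by metis
  note space = pos_radon_measuresD(1)[OF \<mu>(1)]
  have int: "(\<integral>\<xi>. Phi e B f \<xi> \<partial>\<mu>) = blinfun_apply \<phi> f" for f
    unfolding \<mu>(3)[symmetric]
    by (rule Bochner_Integration.integral_cong) (auto simp: \<Psi>_def space)
  have adj: "Phi_adj e B \<mu> = \<phi>"
    by (rule blinfun_eqI) (simp add: Phi_adj_apply[OF sc \<mu>(1)] int)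
  \<comment> \<open>The norm of \<phi> is at most the mass by \<open>norm_Phi_adj_le\<close>, and
    the mass was bounded by the norm of \<phi>, so the two agree.\<close>
  have op: "\<mu> \<in> M_op e B"
    using \<mu>(1,2) norm_Phi_adj_le[OF sc \<mu>(1)] by (simp add: M_op_def adj space)

  let ?F = "msupp B \<mu>"
  have upper: "shadow e B i K ?F \<subseteq> S \<union> {i 0}"
    using \<mu>(4) by (auto simp: shadow_eq E_def T_def)
  have F: "closedin B ?F" by (rule closedin_msupp)
  have shadow_closed: "closedin K (shadow e B i K ?F)"
  proof -
    have "compactin K (p1 ` ?F)" "compactin K (p2 ` ?F)"
      using image_compactin[OF closedin_compact_space[OF B(1) F]] p by blast+
    then show ?thesis
      unfolding shadow_eq using compactin_imp_closedin[OF K(2)] by (intro closedin_Un) auto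
  qed
  have det: "determining \<phi> {x. i x \<in> V}"
    if V: "openin K V" "shadow e B i K ?F \<subseteq> V" for V
    unfolding determining_def
  proof (intro allI impI)
    fix f assume f: "\<forall>x\<in>{x. i x \<in> V}. lip_fun f x = 0"
    have zero: "Phi e B f \<xi> = 0" if \<xi>: "\<xi> \<in> ?F" for \<xi>
    proof (rule ccontr)
      assume nz: "Phi e B f \<xi> \<noteq> 0"
      \<comment> \<open>A nonzero value at \<xi> would persist on this neighbourhood. By density it
        contains some e(x, y), but f vanishes at both x and y, so the quotient there is 0.\<close>
      let ?U = "{\<eta> \<in> topspace B. p1 \<eta> \<in> V} \<inter> {\<eta> \<in> topspace B. p2 \<eta> \<in> V} \<inter>
        {\<eta> \<in> topspace B. Phi e B f \<eta> \<in> - {0}}"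
      have "openin B ?U"
        by (intro openin_Int openin_continuous_map_preimage[OF p(1) V(1)]
            openin_continuous_map_preimage[OF p(2) V(1)]
            openin_continuous_map_preimage[OF Phi_works(1)[OF sc]]) (simp add: open_Compl)
      moreover have "\<xi> \<in> ?U"
        using \<xi> nz V(2) closedin_subset[OF F] by (auto simp: shadow_eq)
      ultimately obtain x y where xy: "x \<noteq> y" "e (x, y) \<in> ?U" using dense' by blast
      then have "i x \<in> V" "i y \<in> V" using pe by auto
      then have "Phi e B f (e (x, y)) = 0" using f Phi_works(2)[OF sc xy(1), of f] by simp
      then show False using xy(2) by simp
    qed
    have "AE \<xi> in \<mu>. Phi e B f \<xi> = 0"
    proof (rule AE_I)
      show "{\<xi> \<in> space \<mu>. Phi e B f \<xi> \<noteq> 0} \<subseteq> topspace B - ?F"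
        using zero by (auto simp: space)
      show "emeasure \<mu> (topspace B - ?F) = 0" by (rule emeasure_outside_msupp[OF \<mu>(1)])
      show "topspace B - ?F \<in> sets \<mu>"
        using F by (intro pos_radon_measuresD(3)[OF \<mu>(1)]) auto
    qed
    then show "blinfun_apply \<phi> f = 0"
      unfolding int[symmetric] by (rule integral_eq_zero_AE)
  qed
  have lower: "S \<subseteq> shadow e B i K ?F"
  proof
    fix \<zeta> assume \<zeta>: "\<zeta> \<in> S"
    show "\<zeta> \<in> shadow e B i K ?F"
    proof (rule ccontr)
      assume "\<zeta> \<notin> shadow e B i K ?F"
      moreover have "\<zeta> \<in> topspace K"
        using \<zeta> closedin_subset[OF T] by (auto simp: T_def)
      moreover have "regular_space K" using K compact_Hausdorff_imp_regular_space by blast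
      ultimately obtain N V where NV: "openin K N" "openin K V" "\<zeta> \<in> N"
        "shadow e B i K ?F \<subseteq> V" "disjnt N V"
        using shadow_closed unfolding regular_space_def by (metis DiffI)
      \<comment> \<open>The points of M mapped into V form a determining set, so its closure is one
        of those intersected in the extended support; yet it misses the neighbourhood N of
        \<zeta>.\<close>
      have "K closure_of (i ` {x. i x \<in> V}) \<subseteq> topspace K - N"
        by (rule closure_of_minimal) (use NV openin_subset[OF NV(2)] in \<open>auto simp: disjnt_def\<close>)
      moreover have "\<zeta> \<in> K closure_of (i ` {x. i x \<in> V})"
        using \<zeta> det[OF NV(2,4)] by (auto simp: S_def ext_support_alt)
      ultimately show False using NV(3) by blast
    qed
  qed
  show ?thesis
    using op adj lower upper by (auto simp: S_def)
qed

end
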